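(* Let $a,b>0$ with $(ab)^{-1}=n\in\mathbb{N}$ be fixed. For $\gamma>0$ let $$g_1(t) = C_{b,\gamma}\,e^{-\gamma t}\,\chi_{[0,1/b]}(t),\quad t\in\mathbb{R},$$ where $C_{b,\gamma}>0$ is chosen such that $\|g_1\|_2=1$, and let $A(\gamma)$ and $B(\gamma)$ be the sharp lower and upper frame bounds of the Gabor system $\mathcal{G}(g_1,a\mathbb{Z}\times b\mathbb{Z})$. Then for all $\gamma>0$ $$A(\gamma)<n,\quad A'(\gamma)<0 \qquad\text{and}\qquad B(\gamma)>n,\quad B'(\gamma)>0,$$ where $'$ denotes differentiation with respect to $\gamma$. Moreover, the frame condition number is independent of $n$ and is always given by $$\frac{B(\gamma)}{A(\gamma)} = e^{2a\gamma}.$$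
   Context: For $g\in L^2(\mathbb{R})$ and $\lambda=(x,\omega)\in\mathbb{R}^2$ put $\pi(\lambda)g(t) = g(t-x)e^{2\pi i\omega t}$. For a lattice $\Lambda\subset\mathbb{R}^2$ the Gabor system is $\mathcal{G}(g,\Lambda)=\{\pi(\lambda)g \mid \lambda\in\Lambda\}$. The sharp lower and upper frame bounds are the largest constant $A\geq 0$ and the smallest constant $B$ such that $A\|f\|_2^2 \le \sum_{\lambda\in\Lambda}|\langle f,\pi(\lambda)g\rangle|^2 \le B\|f\|_2^2$ for all $f\in L^2(\mathbb{R})$. The frame condition number is $B/A$. $\chi_E$ denotes the indicator function of a set $E$, and $\mathbb{N}=\{1,2,3,\dots\}$. *)

theory Defs
  imports "HOL-Analysis.Analysis"
begin

(* Elements of L^2(R) are represented by Borel functions; every almost-everywhere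
   class has such a representative, and all notions below depend only on the class. *)
definition L2 :: "(real \<Rightarrow> complex) set" where
  "L2 = {f \<in> borel_measurable lborel. integrable lborel (\<lambda>t. (cmod (f t))\<^sup>2)}"

definition L2_inner :: "(real \<Rightarrow> complex) \<Rightarrow> (real \<Rightarrow> complex) \<Rightarrow> complex" where
  "L2_inner f h = (LINT t|lborel. f t * cnj (h t))"

definition L2_norm :: "(real \<Rightarrow> complex) \<Rightarrow> real" where
  "L2_norm f = sqrt (LINT t|lborel. (cmod (f t))\<^sup>2)"

definition tf_shift :: "real \<times> real \<Rightarrow> (real \<Rightarrow> complex) \<Rightarrow> real \<Rightarrow> complex" where
  "tf_shift z g t =
     (case z of (x, \<omega>) \<Rightarrow> g (t - x) * exp (2 * complex_of_real pi * \<i> * complex_of_real (\<omega> * t)))"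

definition rect_lattice :: "real \<Rightarrow> real \<Rightarrow> (real \<times> real) set" where
  "rect_lattice a b = range (\<lambda>k::int. a * of_int k) \<times> range (\<lambda>l::int. b * of_int l)"

(* The sum is taken in the extended nonnegative reals, so it is always meaningful and
   equals infinity when the coefficients are not square summable. *)
definition gabor_sum ::
  "(real \<Rightarrow> complex) \<Rightarrow> (real \<times> real) set \<Rightarrow> (real \<Rightarrow> complex) \<Rightarrow> ennreal" where
  "gabor_sum g \<Lambda> f = (\<Sum>\<^sub>\<infinity>z\<in>\<Lambda>. ennreal ((cmod (L2_inner f (tf_shift z g)))\<^sup>2))"

definition is_lower_frame_bound ::
  "(real \<Rightarrow> complex) \<Rightarrow> (real \<times> real) set \<Rightarrow> real \<Rightarrow> bool" where
  "is_lower_frame_bound g \<Lambda> A \<longleftrightarrow>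
     A \<ge> 0 \<and> (\<forall>f\<in>L2. ennreal (A * (L2_norm f)\<^sup>2) \<le> gabor_sum g \<Lambda> f)"

(* Nonnegativity of B is automatic for real inequalities, as L^2(R) is nontrivial;
   it is explicit here because ennreal sends negative reals to 0. *)
definition is_upper_frame_bound ::
  "(real \<Rightarrow> complex) \<Rightarrow> (real \<times> real) set \<Rightarrow> real \<Rightarrow> bool" where
  "is_upper_frame_bound g \<Lambda> B \<longleftrightarrow>
     B \<ge> 0 \<and> (\<forall>f\<in>L2. gabor_sum g \<Lambda> f \<le> ennreal (B * (L2_norm f)\<^sup>2))"

definition sharp_lower_frame_bound :: "(real \<Rightarrow> complex) \<Rightarrow> (real \<times> real) set \<Rightarrow> real" where
  "sharp_lower_frame_bound g \<Lambda> = (GREATEST A. is_lower_frame_bound g \<Lambda> A)"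

definition sharp_upper_frame_bound :: "(real \<Rightarrow> complex) \<Rightarrow> (real \<times> real) set \<Rightarrow> real" where
  "sharp_upper_frame_bound g \<Lambda> = (LEAST B. is_upper_frame_bound g \<Lambda> B)"

definition frame_condition_number :: "(real \<Rightarrow> complex) \<Rightarrow> (real \<times> real) set \<Rightarrow> real" where
  "frame_condition_number g \<Lambda> = sharp_upper_frame_bound g \<Lambda> / sharp_lower_frame_bound g \<Lambda>"

definition one_sided_exp :: "real \<Rightarrow> real \<Rightarrow> real \<Rightarrow> real \<Rightarrow> complex" where
  "one_sided_exp b c \<gamma> t = complex_of_real (c * exp (- \<gamma> * t) * indicator {0..1/b} t)"

end

theory Submission
  imports Defs
begin

text \<open>The window \<open>g\<^sub>1\<close> lives on an interval of length \<open>1/b\<close>, which is exactly one period of the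
modulations \<open>exp (2\<pi>ib\<ell>t)\<close>. For fixed \<open>k\<close> the inner products of \<open>f\<close> with the atoms at time shift \<open>a k\<close>
are therefore Fourier coefficients of the compactly supported function
\<open>f(t) * cnj (g\<^sub>1(t - a k))\<close>, and Parseval's identity turns the sum over \<open>\<ell>\<close> into an integral
(the situation is known as a painless nonorthogonal expansion). Summing over \<open>k\<close>, the frame
operator is multiplication by the weight \<open>w(t) = (1/b) * (\<Sum>k. |g\<^sub>1(t - a k)|\<^sup>2)\<close>
(\<open>gabor_sum_painless\<close>), and so the sharp frame bounds are the essential infimum and supremum of \<open>w\<close>
(\<open>sharp_lower_frame_bound_multiplier\<close>, \<open>sharp_upper_frame_bound_multiplier\<close>).

Because \<open>1/b = n a\<close>, exactly \<open>n\<close> translates of the window meet at almost every point. Their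
contributions form a geometric sum, whose numerator cancels against the normalisation of \<open>g\<^sub>1\<close>, and
with \<open>s\<close> the residue of \<open>t\<close> modulo \<open>a\<close> one finds
\<open>w(t) = n * 2a\<gamma> / (1 - exp (-2a\<gamma>)) * exp (-2\<gamma>s)\<close> (\<open>gabor_sum_one_sided_exp\<close>). As \<open>s\<close> ranges over
\<open>(0, a)\<close>, with \<open>x = 2a\<gamma>\<close>, this gives
\<open>B = n * x / (1 - exp (-x))\<close> and \<open>A = n * x / (exp x - 1)\<close>. The quotient is \<open>exp x\<close>, and all the
inequalities reduce to the strict tangent inequality \<open>1 + y < exp y\<close> for \<open>y \<noteq> 0\<close>.

The analytic ingredient is Parseval's identity for Fourier series of square integrable functions
(\<open>parseval_fourier\<close>). It follows from the exact formula for the distance of a function to a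
trigonometric sum (\<open>trig_sum_distance\<close>) once trigonometric polynomials are known to be dense
(\<open>L2_approx_trig_poly\<close>): the Stone-Weierstrass theorem on the unit circle handles continuous periodic
functions, and a measurable function is almost everywhere a limit of continuous ones.\<close>

section \<open>Trigonometric polynomials\<close>

definition fourier_char :: "real \<Rightarrow> int \<Rightarrow> real \<Rightarrow> complex" where
  "fourier_char b l t = exp (2 * complex_of_real pi * \<i> * complex_of_real (b * of_int l * t))"

text \<open>As an inductive span the set supports proofs by induction over its elements, which is how closure
under products is shown; \<open>trig_poly_obtain_sum\<close> recovers the finite sum.\<close>
inductive trig_poly :: "real \<Rightarrow> (real \<Rightarrow> complex) \<Rightarrow> bool" for b where
  monomial: "trig_poly b (\<lambda>t. c * fourier_char b l t)"
| add: "trig_poly b S \<Longrightarrow> trig_poly b T \<Longrightarrow> trig_poly b (\<lambda>t. S t + T t)"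

lemma fourier_char_0 [simp]: "fourier_char b 0 t = 1"
  by (simp add: fourier_char_def)

lemma fourier_char_mult: "fourier_char b l t * fourier_char b m t = fourier_char b (l + m) t"
  by (simp add: fourier_char_def exp_add [symmetric] algebra_simps)

lemma fourier_char_cnj: "cnj (fourier_char b l t) = fourier_char b (- l) t"
  by (simp add: fourier_char_def exp_cnj)

lemma norm_fourier_char [simp]: "cmod (fourier_char b l t) = 1"
  by (simp add: fourier_char_def norm_exp_eq_Re)

lemma continuous_on_fourier_char [continuous_intros]: "continuous_on S (fourier_char b l)"
  unfolding fourier_char_def by (intro continuous_intros)

lemma measurable_fourier_char [measurable]: "fourier_char b l \<in> borel_measurable borel"
  by (intro borel_measurable_continuous_onI continuous_on_fourier_char)

lemma measurable_cnj [measurable]: "cnj \<in> borel_measurable borel"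
  by (intro borel_measurable_continuous_onI continuous_intros)

lemma trig_poly_const: "trig_poly b (\<lambda>t. c)"
  using trig_poly.monomial[of b c 0] by simp

lemma trig_poly_monomial_mult:
  assumes "trig_poly b T"
  shows "trig_poly b (\<lambda>t. (c * fourier_char b l t) * T t)"
  using assms
proof induction
  case (monomial d m)
  have "(\<lambda>t. (c * fourier_char b l t) * (d * fourier_char b m t)) = (\<lambda>t. (c * d) * fourier_char b (l + m) t)"
    by (simp add: fourier_char_mult[symmetric] algebra_simps)
  then show ?case by (simp add: trig_poly.monomial)
next
  case (add S T)
  then show ?case using trig_poly.add[OF add.IH] by (simp add: algebra_simps)
qed

lemma trig_poly_mult:
  assumes "trig_poly b S" "trig_poly b T"
  shows "trig_poly b (\<lambda>t. S t * T t)"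
  using assms
proof induction
  case (monomial c l)
  then show ?case by (rule trig_poly_monomial_mult)
next
  case (add S1 S2)
  show ?case using trig_poly.add[OF add.IH(1)[OF add.prems] add.IH(2)[OF add.prems]]
    by (simp add: algebra_simps)
qed

lemma trig_poly_obtain_sum:
  assumes "trig_poly b T"
  obtains N d where "finite N" "T = (\<lambda>t. \<Sum>l\<in>N. d l * fourier_char b l t)"
proof -
  have "\<exists>N d. finite N \<and> T = (\<lambda>t. \<Sum>l\<in>N. d l * fourier_char b l t)"
    using assms
  proof induction
    case (monomial c l)
    show ?case by (intro exI[of _ "{l}"] exI[of _ "\<lambda>_. c"]) simp
  next
    case (add S T)
    then obtain N d M e where
      S: "finite N" "S = (\<lambda>t. \<Sum>l\<in>N. d l * fourier_char b l t)" and
      T: "finite M" "T = (\<lambda>t. \<Sum>l\<in>M. e l * fourier_char b l t)" by blast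
    let ?c = "\<lambda>l. (if l \<in> N then d l else 0) + (if l \<in> M then e l else 0)"
    have "(\<Sum>l\<in>N \<union> M. ?c l * fourier_char b l t) = S t + T t" for t
    proof -
      have "(\<Sum>l\<in>N \<union> M. ?c l * fourier_char b l t) =
        (\<Sum>l\<in>N \<union> M. (if l \<in> N then d l * fourier_char b l t else 0)) +
        (\<Sum>l\<in>N \<union> M. (if l \<in> M then e l * fourier_char b l t else 0))"
        unfolding sum.distrib[symmetric] by (intro sum.cong) (auto simp: algebra_simps)
      also have "(\<Sum>l\<in>N \<union> M. (if l \<in> N then d l * fourier_char b l t else 0)) = S t"
        unfolding S(2) using S(1) T(1) by (intro sum.mono_neutral_cong_right) auto
      also have "(\<Sum>l\<in>N \<union> M. (if l \<in> M then e l * fourier_char b l t else 0)) = T t"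
        unfolding T(2) using S(1) T(1) by (intro sum.mono_neutral_cong_right) auto
      finally show ?thesis .
    qed
    then show ?case using S(1) T(1) by (intro exI[of _ "N \<union> M"] exI[of _ ?c]) auto
  qed
  then show ?thesis using that by blast
qed

lemma trig_poly_continuous:
  assumes "trig_poly b T" shows "continuous_on S T"
  using assms by induction (auto intro!: continuous_intros)

section \<open>Approximation of continuous periodic functions\<close>

text \<open>On the circle the coordinates are \<open>Re z = (z + cnj z)/2\<close> and \<open>Im z = (z - cnj z)/(2i)\<close>, and the
conjugate of a character is again a character; hence real polynomials in the coordinates, the functions
that the Stone-Weierstrass theorem provides, pull back to trigonometric polynomials.\<close>
lemma trig_poly_real_polynomial_function:
  assumes "real_polynomial_function p"
  shows "trig_poly b (\<lambda>t. of_real (p (fourier_char b 1 t)))"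
  using assms
proof induction
  case (linear p)
  have p: "p z = Re z * p 1 + Im z * p \<i>" for z
  proof -
    have "p z = p (Re z *\<^sub>R 1 + Im z *\<^sub>R \<i>)"
      by (rule arg_cong[of _ _ p]) (simp add: complex_eq_iff)
    also have "\<dots> = Re z * p 1 + Im z * p \<i>"
      using linear by (simp add: linear_add linear_scale bounded_linear.linear)
    finally show ?thesis .
  qed
  let ?e = "fourier_char b"
  have cplx: "of_real (p z) = (p 1 / 2 - \<i> * p \<i> / 2) * z + (p 1 / 2 + \<i> * p \<i> / 2) * cnj z" for z
    by (subst p) (auto simp: complex_eq_iff algebra_simps)
  let ?T = "\<lambda>t. (p 1 / 2 - \<i> * p \<i> / 2) * ?e 1 t + (p 1 / 2 + \<i> * p \<i> / 2) * ?e (-1) t"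
  have "trig_poly b ?T"
    by (intro trig_poly.intros)
  also have "?T = (\<lambda>t. of_real (p (?e 1 t)))"
    by (rule ext, subst cplx, simp only: fourier_char_cnj)
  finally show ?case .
next
  case (const c)
  then show ?case by (rule trig_poly_const)
next
  case (add f g)
  then show ?case using trig_poly.add by fastforce
next
  case (mult f g)
  then show ?case using trig_poly_mult by fastforce
qed

text \<open>A function on the period interval with equal end values is a loop, and a loop factors continuously
through the unit circle via \<open>Arg2pi\<close>. Continuity at the branch point is obtained from the correspondence
between homotopies of loops and homotopies of circle maps, applied to the constant homotopy.\<close>
lemma trig_poly_uniform_approx_real:
  fixes h :: "real \<Rightarrow> real"
  assumes b: "b > 0" and cont: "continuous_on {x..x + 1/b} h" and per: "h x = h (x + 1/b)" and e: "e > 0"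
  obtains T where "trig_poly b T" "\<And>t. t \<in> {x..x + 1/b} \<Longrightarrow> cmod (of_real (h t) - T t) < e"
proof -
  define p where "p = (\<lambda>s. h (x + s / b))"
  have "path p" unfolding path_def p_def
    using b by (intro continuous_on_compose2[OF cont] continuous_intros) (auto simp: field_simps)
  moreover have "pathfinish p = pathstart p"
    using per by (simp add: p_def pathfinish_def pathstart_def)
  ultimately have "homotopic_loops UNIV p p" by (simp add: homotopic_loops_refl)
  from homotopic_loops_imp_homotopic_circlemaps[OF this]
  have "continuous_on (sphere 0 1) (p \<circ> (\<lambda>z. Arg2pi z / (2 * pi)))"
    using homotopic_with_imp_continuous by blast
  from Stone_Weierstrass_real_polynomial_function[OF compact_sphere this e]
  obtain q where q: "real_polynomial_function q"
    "\<And>z. z \<in> sphere 0 1 \<Longrightarrow> \<bar>(p \<circ> (\<lambda>z. Arg2pi z / (2 * pi))) z - q z\<bar> < e" by blast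
  have main: "\<bar>h t - q (exp (\<i> * of_real (2 * pi * b * (t - x))))\<bar> < e" if "t \<in> {x..x + 1/b}" for t
  proof -
    let ?s = "b * (t - x)"
    let ?z = "exp (\<i> * of_real (2 * pi * b * (t - x)))"
    have s: "0 \<le> ?s" "?s \<le> 1" using that b by (auto simp: field_simps)
    have "p (Arg2pi ?z / (2 * pi)) = h t"
      \<comment> \<open>At the right end point \<open>Arg2pi\<close> has jumped back to \<open>0\<close>; equality of the end values repairs this.\<close>
    proof (cases "?s = 1")
      case True
      then have "t = x + 1/b" using b by (simp add: field_simps)
      have "?z = 1" using True exp_two_pi_i by (simp add: mult.assoc) (simp add: mult.commute)
      then have "Arg2pi ?z = 0" using Arg2pi_of_real[of 1] by simp
      then show ?thesis using \<open>t = x + 1/b\<close> per by (simp add: p_def)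
    next
      case False
      then have "Arg2pi ?z = 2 * pi * ?s"
        using s mult_strict_left_mono[of ?s 1 "2 * pi"] by (subst Arg2pi_exp) (auto simp: mult.assoc)
      then show ?thesis using b by (simp add: p_def)
    qed
    moreover have "?z \<in> sphere 0 1" by (simp del: of_real_mult)
    ultimately show ?thesis using q(2)[of ?z] by simp
  qed
  \<comment> \<open>The circle parameter starts at the left end \<open>x\<close>, the characters start at \<open>0\<close>; a rotation by \<open>w\<close>
    reconciles the two and preserves polynomials.\<close>
  define w where "w = cnj (fourier_char b 1 x)"
  have wz: "exp (\<i> * of_real (2 * pi * b * (t - x))) = w * fourier_char b 1 t" for t
    by (simp add: w_def fourier_char_def exp_cnj exp_add[symmetric] algebra_simps)
  have "real_polynomial_function (\<lambda>z. q (w * z))"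
  proof -
    have "polynomial_function (\<lambda>z. w * z)"
      by (intro polynomial_function_bounded_linear bounded_linear_mult_right)
    from real_polynomial_function_compose[OF this q(1)] show ?thesis by (simp add: o_def)
  qed
  from trig_poly_real_polynomial_function[OF this, of b]
  have "trig_poly b (\<lambda>t. of_real (q (w * fourier_char b 1 t)))" .
  moreover have "cmod (of_real (h t) - of_real (q (w * fourier_char b 1 t))) < e" if "t \<in> {x..x + 1/b}" for t
    using main[OF that] unfolding wz by (simp flip: of_real_diff)
  ultimately show ?thesis by (rule that)
qed

lemma trig_poly_uniform_approx:
  fixes h :: "real \<Rightarrow> complex"
  assumes b: "b > 0" and cont: "continuous_on {x..x + 1/b} h" and per: "h x = h (x + 1/b)" and e: "e > 0"
  obtains T where "trig_poly b T" "\<And>t. t \<in> {x..x + 1/b} \<Longrightarrow> cmod (h t - T t) < e"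
proof -
  obtain S where S: "trig_poly b S" "\<And>t. t \<in> {x..x + 1/b} \<Longrightarrow> cmod (of_real (Re (h t)) - S t) < e / 2"
    by (rule trig_poly_uniform_approx_real[of b x "\<lambda>t. Re (h t)" "e/2"])
      (use assms in \<open>auto intro!: continuous_intros\<close>)
  obtain T where T: "trig_poly b T" "\<And>t. t \<in> {x..x + 1/b} \<Longrightarrow> cmod (of_real (Im (h t)) - T t) < e / 2"
    by (rule trig_poly_uniform_approx_real[of b x "\<lambda>t. Im (h t)" "e/2"])
      (use assms in \<open>auto intro!: continuous_intros\<close>)
  have "trig_poly b (\<lambda>t. S t + \<i> * T t)"
    by (intro trig_poly.add S trig_poly_mult trig_poly_const T)
  moreover have "cmod (h t - (S t + \<i> * T t)) < e" if "t \<in> {x..x + 1/b}" for t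
  proof -
    have "h t - (S t + \<i> * T t) = (of_real (Re (h t)) - S t) + \<i> * (of_real (Im (h t)) - T t)"
      by (subst complex_eq[of "h t"]) (simp add: algebra_simps)
    also have "cmod \<dots> \<le> cmod (of_real (Re (h t)) - S t) + cmod (of_real (Im (h t)) - T t)"
      by (rule norm_triangle_le) (simp add: norm_mult)
    also have "\<dots> < e" using S(2)[OF that] T(2)[OF that] by simp
    finally show ?thesis .
  qed
  ultimately show ?thesis by (rule that)
qed

section \<open>Density of trigonometric polynomials in square mean\<close>

lemma norm_add_sq_le:
  fixes u v :: "'a::real_normed_vector"
  shows "(norm (u + v))\<^sup>2 \<le> 2 * (norm u)\<^sup>2 + 2 * (norm v)\<^sup>2"
proof -
  have "(norm (u + v))\<^sup>2 \<le> (norm u + norm v)\<^sup>2"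
    by (intro power_mono norm_triangle_ineq) simp
  also have "\<dots> \<le> 2 * (norm u)\<^sup>2 + 2 * (norm v)\<^sup>2"
    using zero_le_power2[of "norm u - norm v"] by (simp add: power2_sum power2_diff)
  finally show ?thesis .
qed

lemma integrable_indicator_Icc [simp]: "integrable lborel (indicator {x..y::real} :: real \<Rightarrow> real)"
  by (rule integrable_real_indicator) (auto simp: emeasure_lborel_Icc_eq)

lemma integrable_bounded_on_interval:
  fixes u :: "real \<Rightarrow> 'a::{banach, second_countable_topology}"
  assumes "u \<in> borel_measurable borel" "\<And>t. t \<in> {x..y} \<Longrightarrow> norm (u t) \<le> K" "\<And>t. t \<notin> {x..y} \<Longrightarrow> u t = 0"
  shows "integrable lborel u"
proof (rule Bochner_Integration.integrable_bound)
  show "integrable lborel (\<lambda>t. K * indicator {x..y} t :: real)" by simp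
  show "AE t in lborel. norm (u t) \<le> norm (K * indicator {x..y} t :: real)"
  proof (rule AE_I2)
    fix t
    show "norm (u t) \<le> norm (K * indicator {x..y} t :: real)"
      using assms(2,3)[of t] by (auto split: split_indicator)
  qed
qed (use assms(1) in simp)

text \<open>A Borel function is almost everywhere the limit of continuous functions \<open>g n\<close>. Clipping these at
height \<open>K\<close> supplies the majorant for dominated convergence, and multiplying with a plateau function
\<open>cut n\<close> that vanishes at the end points makes the approximants periodic without affecting the limit
almost everywhere.\<close>
lemma bounded_approx_continuous:
  fixes F :: "real \<Rightarrow> complex"
  assumes meas [measurable]: "F \<in> borel_measurable borel" and bd: "\<And>t. cmod (F t) \<le> K" and K: "K > 0"
    and supp: "\<And>t. t \<notin> {x..y} \<Longrightarrow> F t = 0" and e: "e > 0"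
  obtains h where "continuous_on UNIV h" "\<And>t. t \<notin> {x<..<y} \<Longrightarrow> h t = 0" "\<And>t. cmod (h t) \<le> K"
    "(LINT t|lborel. (cmod (F t - h t))\<^sup>2) < e"
proof -
  have "F \<in> borel_measurable lebesgue" using measurable_completion[of F lborel borel] by simp
  then have "F measurable_on UNIV" by (rule lebesgue_measurable_imp_measurable_on) simp
  then obtain N g where N: "negligible N" and g: "\<And>n. continuous_on UNIV (g n)"
    and lim: "\<And>t. t \<notin> N \<Longrightarrow> (\<lambda>n. g n t) \<longlonglongrightarrow> F t"
    unfolding measurable_on_def by auto
  define cut where "cut n t = min 1 (max 0 (real n * min (t - x) (y - t)))" for n t
  define G where "G n t = complex_of_real (cut n t * (K / max K (cmod (g n t)))) * g n t" for n t
  have contG: "continuous_on UNIV (G n)" for n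
    unfolding G_def cut_def using K by (intro continuous_intros g) auto
  have [measurable]: "G n \<in> borel_measurable borel" for n
    using contG by (rule borel_measurable_continuous_onI)
  have G0: "G n t = 0" if "t \<notin> {x<..<y}" for n t
  proof -
    have "real n * min (t - x) (y - t) \<le> 0"
      using that by (intro mult_nonneg_nonpos) (auto simp: min_def)
    then show ?thesis by (simp add: G_def cut_def)
  qed
  have Gbd: "cmod (G n t) \<le> K" for n t
  proof -
    have c: "0 \<le> cut n t" "cut n t \<le> 1" by (simp_all add: cut_def)
    have "cmod (G n t) = cut n t * (K * (cmod (g n t) / max K (cmod (g n t))))"
      using K c(1) by (simp add: G_def norm_mult norm_divide abs_of_pos less_max_iff_disj del: of_real_mult of_real_divide)
    also have "\<dots> \<le> 1 * (K * 1)"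
      using K c by (intro mult_mono) (auto simp: divide_le_eq)
    finally show ?thesis by simp
  qed
  have conv: "(\<lambda>n. G n t) \<longlonglongrightarrow> F t" if t: "t \<notin> N" "t \<noteq> x" "t \<noteq> y" for t
  proof (cases "t \<in> {x<..<y}")
    case False
    then show ?thesis using t supp[of t] G0[of t] by auto
  next
    case True
    define m where "m = min (t - x) (y - t)"
    have m: "m > 0" using True by (simp add: m_def)
    have "\<forall>\<^sub>F n in sequentially. cut n t = 1"
      using eventually_ge_at_top[of "nat \<lceil>1 / m\<rceil>"]
    proof eventually_elim
      case (elim n)
      then have "real n \<ge> 1 / m" by linarith
      then have "real n * m \<ge> 1" using m by (simp add: field_simps)
      then show ?case by (simp add: cut_def m_def[symmetric])
    qed
    then have "(\<lambda>n. cut n t) \<longlonglongrightarrow> 1" by (rule tendsto_eventually)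
    then have "(\<lambda>n. G n t) \<longlonglongrightarrow> complex_of_real (1 * (K / max K (cmod (F t)))) * F t"
      unfolding G_def using K by (intro tendsto_intros lim t) auto
    moreover have "max K (cmod (F t)) = K" using bd[of t] by simp
    ultimately show ?thesis using K by simp
  qed
  have "(\<lambda>n. LINT t|lborel. (cmod (F t - G n t))\<^sup>2) \<longlonglongrightarrow> (LINT t::real|lborel. 0 :: real)"
  proof (rule integral_dominated_convergence)
    show "integrable lborel (\<lambda>t. (2 * K)\<^sup>2 * indicator {x..y} t :: real)" by simp
    have "AE t in lborel. t \<notin> N \<and> t \<noteq> x \<and> t \<noteq> y"
    proof -
      have "AE t in lebesgue. t \<notin> N"
        using N by (simp add: negligible_iff_null_sets AE_not_in)
      then have "AE t in lborel. t \<notin> N" by (simp add: AE_completion_iff)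
      then show ?thesis using AE_lborel_singleton[of x] AE_lborel_singleton[of y] by eventually_elim auto
    qed
    then show "AE t in lborel. (\<lambda>n. (cmod (F t - G n t))\<^sup>2) \<longlonglongrightarrow> 0"
    proof eventually_elim
      case (elim t)
      then have "(\<lambda>n. (cmod (F t - G n t))\<^sup>2) \<longlonglongrightarrow> (cmod (F t - F t))\<^sup>2"
        by (intro tendsto_intros conv) auto
      then show ?case by simp
    qed
    show "AE t in lborel. norm ((cmod (F t - G n t))\<^sup>2) \<le> (2 * K)\<^sup>2 * indicator {x..y} t" for n
    proof (rule AE_I2)
      fix t
      have "cmod (F t - G n t) \<le> 2 * K"
        using norm_triangle_ineq4[of "F t" "G n t"] bd[of t] Gbd[of n t] by simp
      then have "(cmod (F t - G n t))\<^sup>2 \<le> (2 * K)\<^sup>2" by (intro power_mono) auto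
      then show "norm ((cmod (F t - G n t))\<^sup>2) \<le> (2 * K)\<^sup>2 * indicator {x..y} t"
        using supp[of t] G0[of t n] by (auto split: split_indicator)
    qed
  qed simp_all
  from order_tendstoD(2)[OF this, of e] e obtain n where "(LINT t|lborel. (cmod (F t - G n t))\<^sup>2) < e"
    by (auto simp: eventually_sequentially)
  with contG G0 Gbd show ?thesis using that by blast
qed

text \<open>Truncation at a large height reduces the approximation problem to bounded functions.\<close>
lemma L2_approx_bounded:
  fixes F :: "real \<Rightarrow> complex"
  assumes meas [measurable]: "F \<in> borel_measurable borel" and int: "integrable lborel (\<lambda>t. (cmod (F t))\<^sup>2)"
    and e: "e > 0"
  obtains K where "K > 0" "(LINT t|lborel. (cmod (F t - (if cmod (F t) \<le> K then F t else 0)))\<^sup>2) < e"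
proof -
  let ?G = "\<lambda>n::nat. \<lambda>t. if cmod (F t) \<le> real n then F t else 0"
  have "(\<lambda>n. LINT t|lborel. (cmod (F t - ?G n t))\<^sup>2) \<longlonglongrightarrow> (LINT t::real|lborel. 0 :: real)"
  proof (rule integral_dominated_convergence)
    show "integrable lborel (\<lambda>t. (cmod (F t))\<^sup>2)" by (rule int)
    show "AE t in lborel. (\<lambda>n. (cmod (F t - ?G n t))\<^sup>2) \<longlonglongrightarrow> 0"
    proof (rule AE_I2)
      fix t
      have "\<forall>\<^sub>F n in sequentially. (cmod (F t - ?G n t))\<^sup>2 = 0"
        using eventually_ge_at_top[of "nat \<lceil>cmod (F t)\<rceil>"]
        by eventually_elim (use of_nat_ceiling order_trans in auto)
      then show "(\<lambda>n. (cmod (F t - ?G n t))\<^sup>2) \<longlonglongrightarrow> 0" by (rule tendsto_eventually)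
    qed
  qed auto
  from order_tendstoD(2)[OF this, of e] e obtain n0 where
    "\<And>n. n \<ge> n0 \<Longrightarrow> (LINT t|lborel. (cmod (F t - ?G n t))\<^sup>2) < e"
    by (auto simp: eventually_sequentially)
  from this[of "Suc n0"] show ?thesis by (intro that[of "real (Suc n0)"]) auto
qed

text \<open>The three errors made by truncating, by passing to a continuous function and by uniform
approximation are added by means of \<open>norm_add_sq_le\<close>, applied twice.\<close>
lemma L2_approx_trig_poly:
  fixes F :: "real \<Rightarrow> complex"
  assumes b: "b > 0"
    and meas [measurable]: "F \<in> borel_measurable borel" and int: "integrable lborel (\<lambda>t. (cmod (F t))\<^sup>2)"
    and supp: "\<And>t. t \<notin> {x..x + 1/b} \<Longrightarrow> F t = 0" and e: "e > 0"
  obtains T where "trig_poly b T" "(LINT t|lborel. (cmod (F t - indicator {x..x + 1/b} t * T t))\<^sup>2) < e"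
proof -
  let ?I = "{x..x + 1/b}"
  obtain K where K: "K > 0" and FK: "(LINT t|lborel. (cmod (F t - (if cmod (F t) \<le> K then F t else 0)))\<^sup>2) < e / 8"
    using L2_approx_bounded[OF meas int, of "e / 8"] e by auto
  define F' where "F' t = (if cmod (F t) \<le> K then F t else 0)" for t
  have [measurable]: "F' \<in> borel_measurable borel" unfolding F'_def by measurable
  have F'K: "cmod (F' t) \<le> K" for t using K by (simp add: F'_def)
  have F'0: "F' t = 0" if "t \<notin> ?I" for t using supp[OF that] by (simp add: F'_def)
  obtain h where h: "continuous_on UNIV h" "\<And>t. t \<notin> {x<..<x + 1/b} \<Longrightarrow> h t = 0" "\<And>t. cmod (h t) \<le> K"
    and F'h: "(LINT t|lborel. (cmod (F' t - h t))\<^sup>2) < e / 16"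
    using bounded_approx_continuous[of F' K x "x + 1/b" "e / 16"] F'K F'0 K e by auto
  have [measurable]: "h \<in> borel_measurable borel" using h(1) by (rule borel_measurable_continuous_onI)
  \<comment> \<open>A uniform error \<open>d\<close> over an interval of length \<open>1/b\<close> costs \<open>d\<^sup>2 / b\<close> in square mean.\<close>
  define d where "d = sqrt (e * b / 16)"
  have d: "d > 0" using e b by (simp add: d_def)
  obtain T where T: "trig_poly b T" and hT: "\<And>t. t \<in> ?I \<Longrightarrow> cmod (h t - T t) < d"
    using trig_poly_uniform_approx[of b x h d] b d h(2)[of x] h(2)[of "x + 1/b"]
      continuous_on_subset[OF h(1)] by auto
  have [measurable]: "T \<in> borel_measurable borel"
    using trig_poly_continuous[OF T] by (rule borel_measurable_continuous_onI)
  let ?T = "\<lambda>t. indicator ?I t * T t"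
  have hT': "(cmod (h t - ?T t))\<^sup>2 \<le> d\<^sup>2 * indicator ?I t" for t
    using hT[of t] h(2)[of t] by (auto split: split_indicator intro!: power_mono)
  have i1: "integrable lborel (\<lambda>t. (cmod (F t - F' t))\<^sup>2)"
    by (rule Bochner_Integration.integrable_bound[OF int]) (auto simp: F'_def)
  have i2: "integrable lborel (\<lambda>t. (cmod (F' t - h t))\<^sup>2)"
  proof (rule integrable_bounded_on_interval[where x = x and y = "x + 1/b" and K = "(2 * K)\<^sup>2"])
    fix t
    have "cmod (F' t - h t) \<le> 2 * K"
      using norm_triangle_ineq4[of "F' t" "h t"] F'K[of t] h(3)[of t] by simp
    then show "norm ((cmod (F' t - h t))\<^sup>2) \<le> (2 * K)\<^sup>2" using power_mono[of _ "2 * K" 2] by simp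
    show "t \<notin> ?I \<Longrightarrow> (cmod (F' t - h t))\<^sup>2 = 0" using F'0[of t] h(2)[of t] by auto
  qed simp
  have i3: "integrable lborel (\<lambda>t. d\<^sup>2 * indicator ?I t :: real)" by simp
  have "(LINT t|lborel. (cmod (F t - ?T t))\<^sup>2) \<le>
    (LINT t|lborel. 2 * (cmod (F t - F' t))\<^sup>2 + 4 * (cmod (F' t - h t))\<^sup>2 + 4 * (d\<^sup>2 * indicator ?I t))"
  proof (rule integral_mono')
    show "integrable lborel
      (\<lambda>t. 2 * (cmod (F t - F' t))\<^sup>2 + 4 * (cmod (F' t - h t))\<^sup>2 + 4 * (d\<^sup>2 * indicator ?I t))"
      by (intro Bochner_Integration.integrable_add integrable_mult_right i1 i2 i3)
    fix t
    have "(cmod (F t - ?T t))\<^sup>2 = (cmod ((F t - F' t) + ((F' t - h t) + (h t - ?T t))))\<^sup>2"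
      by simp
    also have "\<dots> \<le> 2 * (cmod (F t - F' t))\<^sup>2 + 2 * (cmod ((F' t - h t) + (h t - ?T t)))\<^sup>2"
      by (rule norm_add_sq_le)
    also have "\<dots> \<le> 2 * (cmod (F t - F' t))\<^sup>2 + 2 * (2 * (cmod (F' t - h t))\<^sup>2 + 2 * (cmod (h t - ?T t))\<^sup>2)"
      by (intro add_left_mono mult_left_mono norm_add_sq_le) simp
    finally show "(cmod (F t - ?T t))\<^sup>2 \<le>
        2 * (cmod (F t - F' t))\<^sup>2 + 4 * (cmod (F' t - h t))\<^sup>2 + 4 * (d\<^sup>2 * indicator ?I t)"
      using hT'[of t] by simp
  qed simp
  also have "\<dots> = 2 * (LINT t|lborel. (cmod (F t - F' t))\<^sup>2) + 4 * (LINT t|lborel. (cmod (F' t - h t))\<^sup>2)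
      + 4 * (LINT t|lborel. d\<^sup>2 * indicator ?I t)"
    using i1 i2 i3 by (simp del: integrable_mult_right_iff integrable_indicator_iff
      add: Bochner_Integration.integral_add Bochner_Integration.integrable_add)
  also have "(LINT t|lborel. d\<^sup>2 * indicator ?I t) = d\<^sup>2 / b" using b by simp
  also have "d\<^sup>2 / b = e / 16" using e b by (simp add: d_def)
  also have "2 * (LINT t|lborel. (cmod (F t - F' t))\<^sup>2) + 4 * (LINT t|lborel. (cmod (F' t - h t))\<^sup>2) + 4 * (e / 16) < e"
    using FK F'h e unfolding F'_def by linarith
  finally show ?thesis using that T by blast
qed

section \<open>Parseval's identity\<close>

lemma fourier_char_orthogonal:
  assumes b: "b > 0"
  shows "(LINT t|lborel. indicator {x..x + 1/b} t * fourier_char b l t) = (if l = 0 then of_real (1/b) else 0)"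
proof (cases "l = 0")
  case True
  have "(LINT t|lborel. indicator {x..x + 1/b} t * fourier_char b l t) = (LINT t|lborel. complex_of_real (indicator {x..x + 1/b} t))"
    using True by (intro Bochner_Integration.integral_cong) (auto split: split_indicator)
  also have "\<dots> = of_real (1/b)" using b by (subst integral_complex_of_real) simp
  finally show ?thesis using True by simp
next
  case False
  define w where "w = 2 * complex_of_real pi * \<i> * of_real (b * of_int l)"
  have w: "w \<noteq> 0" using False b by (simp add: w_def)
  have ew: "fourier_char b l t = exp (w * of_real t)" for t
    by (simp add: fourier_char_def w_def algebra_simps)
  have "(LINT t|lborel. indicator {x..x + 1/b} t *\<^sub>R fourier_char b l t) =
      exp (w * of_real (x + 1/b)) / w - exp (w * of_real x) / w"
  proof (rule integral_FTC_Icc)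
    show "continuous_on {x..x + 1/b} (fourier_char b l)" by (rule continuous_on_fourier_char)
    fix t
    have "((\<lambda>z. exp (w * z) / w) has_field_derivative exp (w * of_real t)) (at (of_real t))"
      using w by (auto intro!: derivative_eq_intros)
    then show "((\<lambda>t. exp (w * of_real t) / w) has_vector_derivative fourier_char b l t) (at t within {x..x + 1/b})"
      unfolding ew by (rule has_vector_derivative_at_within[OF has_vector_derivative_real_field])
  qed (use b in simp)
  also have "exp (w * of_real (x + 1/b)) = exp (w * of_real x)"
  proof -
    have "w * of_real (x + 1/b) = w * of_real x + w / of_real b"
      by (simp add: distrib_left)
    also have "w / of_real b = (2 * of_int l * pi) * \<i>"
      using b by (simp add: w_def)
    finally show ?thesis
      using exp_integer_2pi[of "of_int l"] by (simp add: exp_add)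
  qed
  finally have "(LINT t|lborel. indicator {x..x + 1/b} t *\<^sub>R fourier_char b l t) = 0" by simp
  moreover have "indicator {x..x + 1/b} t * fourier_char b l t = indicator {x..x + 1/b} t *\<^sub>R fourier_char b l t" for t
    by (simp split: split_indicator)
  ultimately show ?thesis using False by simp
qed

lemma integrable_L2_times_bounded:
  fixes F G :: "real \<Rightarrow> complex"
  assumes [measurable]: "F \<in> borel_measurable borel" "G \<in> borel_measurable borel"
    and int: "integrable lborel (\<lambda>t. (cmod (F t))\<^sup>2)" and supp: "\<And>t. t \<notin> {x..y} \<Longrightarrow> F t = 0"
    and G: "\<And>t. cmod (G t) \<le> 1"
  shows "integrable lborel (\<lambda>t. F t * G t)"
proof (rule Bochner_Integration.integrable_bound)
  show "integrable lborel (\<lambda>t. indicator {x..y} t + (cmod (F t))\<^sup>2)"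
    by (intro Bochner_Integration.integrable_add int) simp
  show "AE t in lborel. norm (F t * G t) \<le> norm (indicator {x..y} t + (cmod (F t))\<^sup>2)"
  proof (rule AE_I2)
    fix t
    have "cmod (F t * G t) \<le> cmod (F t)"
      using G[of t] by (simp add: norm_mult mult_left_le)
    moreover have "cmod (F t) \<le> 1 + (cmod (F t))\<^sup>2"
      using zero_le_power2[of "cmod (F t) - 1/2"] by (simp add: power2_diff power_divide)
    ultimately show "norm (F t * G t) \<le> norm (indicator {x..y} t + (cmod (F t))\<^sup>2)"
      using supp[of t] by (auto split: split_indicator)
  qed
qed simp

lemma norm_sq_diff: "complex_of_real ((cmod (u - v))\<^sup>2) = of_real ((cmod u)\<^sup>2) - u * cnj v - v * cnj u + v * cnj v"
  unfolding complex_norm_square by (simp add: algebra_simps)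

text \<open>Expanding the square and using orthogonality, completing the square in the coefficients \<open>d l\<close>
separates the error of the best approximation from the penalty for a wrong choice of coefficients.
The choice \<open>d l = b * c l\<close> gives Bessel's inequality; dropping the penalty shows that no sum with
frequencies in \<open>N\<close> comes closer.\<close>
lemma trig_sum_distance:
  fixes b x :: real and F :: "real \<Rightarrow> complex" and d :: "int \<Rightarrow> complex"
  defines "c \<equiv> (\<lambda>l. LINT t|lborel. F t * cnj (fourier_char b l t))"
  assumes b: "b > 0"
    and meas [measurable]: "F \<in> borel_measurable borel" and int: "integrable lborel (\<lambda>t. (cmod (F t))\<^sup>2)"
    and supp: "\<And>t. t \<notin> {x..x + 1/b} \<Longrightarrow> F t = 0" and N: "finite N"
  shows "(LINT t|lborel. (cmod (F t - indicator {x..x + 1/b} t * (\<Sum>l\<in>N. d l * fourier_char b l t)))\<^sup>2) =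
    (LINT t|lborel. (cmod (F t))\<^sup>2) - b * (\<Sum>l\<in>N. (cmod (c l))\<^sup>2) + (1/b) * (\<Sum>l\<in>N. (cmod (d l - of_real b * c l))\<^sup>2)"
proof -
  let ?I = "{x..x + 1/b}"
  let ?e = "fourier_char b"
  let ?S = "\<lambda>t. indicator ?I t * (\<Sum>l\<in>N. d l * ?e l t) :: complex"
  have c: "c l = (LINT t|lborel. F t * cnj (?e l t))" for l by (simp add: c_def)
  have diag: "(\<Sum>m\<in>N. (d l * cnj (d m)) * (if l - m = 0 then of_real (1/b) else 0)) = d l * cnj (d l) / of_real b"
    if "l \<in> N" for l
    using N that by (simp add: mult_delta_right)
  have iF: "integrable lborel (\<lambda>t. F t * cnj (?e l t))" for l
    by (rule integrable_L2_times_bounded[OF _ _ int supp]) (simp_all add: fourier_char_cnj)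
  have iF': "integrable lborel (\<lambda>t. cnj (F t * cnj (?e l t)))" for l
    using iF[of l] by (rule integrable_cnj)
  have ie: "integrable lborel (\<lambda>t. indicator ?I t * ?e l t)" for l
    by (rule integrable_bounded_on_interval[where K = 1 and x = x and y = "x + 1/b"]) (auto simp: norm_mult)
  have int': "integrable lborel (\<lambda>t. complex_of_real ((cmod (F t))\<^sup>2))"
    using int by (rule integrable_of_real)
  have FS: "F t * cnj (?S t) = (\<Sum>l\<in>N. cnj (d l) * (F t * cnj (?e l t)))" for t
    using supp[of t] by (cases "t \<in> ?I") (auto simp: sum_distrib_left algebra_simps)
  have SF: "?S t * cnj (F t) = (\<Sum>l\<in>N. d l * cnj (F t * cnj (?e l t)))" for t
    using supp[of t] by (cases "t \<in> ?I") (auto simp: sum_distrib_left algebra_simps)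
  have SS: "?S t * cnj (?S t) = (\<Sum>l\<in>N. \<Sum>m\<in>N. (d l * cnj (d m)) * (indicator ?I t * ?e (l - m) t))" for t
  proof (cases "t \<in> ?I")
    case True
    have "?S t * cnj (?S t) = (\<Sum>l\<in>N. \<Sum>m\<in>N. (d l * ?e l t) * (cnj (d m) * ?e (- m) t))"
      using True by (simp add: sum_product fourier_char_cnj)
    also have "\<dots> = (\<Sum>l\<in>N. \<Sum>m\<in>N. (d l * cnj (d m)) * (?e l t * ?e (- m) t))"
      by (simp add: algebra_simps)
    finally show ?thesis using True by (simp add: fourier_char_mult)
  qed simp
  have "complex_of_real (LINT t|lborel. (cmod (F t - ?S t))\<^sup>2) =
    (LINT t|lborel. complex_of_real ((cmod (F t))\<^sup>2)
      - (\<Sum>l\<in>N. cnj (d l) * (F t * cnj (?e l t))) - (\<Sum>l\<in>N. d l * cnj (F t * cnj (?e l t)))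
      + (\<Sum>l\<in>N. \<Sum>m\<in>N. (d l * cnj (d m)) * (indicator ?I t * ?e (l - m) t)))"
    unfolding integral_complex_of_real[symmetric] norm_sq_diff FS SF SS ..
  also have "\<dots> = (LINT t|lborel. complex_of_real ((cmod (F t))\<^sup>2))
      - (\<Sum>l\<in>N. cnj (d l) * (LINT t|lborel. F t * cnj (?e l t)))
      - (\<Sum>l\<in>N. d l * (LINT t|lborel. cnj (F t * cnj (?e l t))))
      + (\<Sum>l\<in>N. \<Sum>m\<in>N. (d l * cnj (d m)) * (LINT t|lborel. indicator ?I t * ?e (l - m) t))"
    by (intro has_bochner_integral_integral_eq has_bochner_integral_add has_bochner_integral_diff
        has_bochner_integral_sum has_bochner_integral_mult_right has_bochner_integral_integrable int' iF iF' ie)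
  also have "\<dots> = of_real (LINT t|lborel. (cmod (F t))\<^sup>2) - (\<Sum>l\<in>N. cnj (d l) * c l)
      - (\<Sum>l\<in>N. d l * cnj (c l)) + (\<Sum>l\<in>N. d l * cnj (d l) / of_real b)"
    by (simp only: integral_complex_of_real Bochner_Integration.integral_cnj c[symmetric] fourier_char_orthogonal[OF b] diag cong: sum.cong)
  also have "\<dots> = of_real ((LINT t|lborel. (cmod (F t))\<^sup>2) - b * (\<Sum>l\<in>N. (cmod (c l))\<^sup>2)
      + (1/b) * (\<Sum>l\<in>N. (cmod (d l - of_real b * c l))\<^sup>2))"
  proof -
    have "of_real b * of_real ((cmod (c l))\<^sup>2) - cnj (d l) * c l - d l * cnj (c l) + d l * cnj (d l) / of_real b
        = of_real ((cmod (d l - of_real b * c l))\<^sup>2) / of_real b" for l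
      unfolding complex_norm_square using b by (simp add: field_simps)
    then have "(\<Sum>l\<in>N. of_real b * of_real ((cmod (c l))\<^sup>2) - cnj (d l) * c l - d l * cnj (c l) + d l * cnj (d l) / of_real b)
        = (\<Sum>l\<in>N. of_real ((cmod (d l - of_real b * c l))\<^sup>2) / of_real b)"
      by simp
    then show ?thesis
      by (simp add: sum.distrib sum_subtractf sum_distrib_left sum_divide_distrib algebra_simps)
  qed
  finally show ?thesis unfolding of_real_eq_iff .
qed

text \<open>Written as integrals over counting measure, unordered sums of extended nonnegative reals come under
Tonelli's theorem.\<close>
lemma infsum_eq_nn_integral_count_space:
  fixes f :: "'a \<Rightarrow> ennreal"
  assumes "countable A" "infinite A"
  shows "infsum f A = (\<integral>\<^sup>+ z. f z \<partial>count_space A)"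
proof -
  have sup: "infsum f A = (SUP F\<in>{F. finite F \<and> F \<subseteq> A}. sum f F)"
    by (rule nonneg_infsum_complete) simp
  show ?thesis
  proof (rule antisym)
    show "infsum f A \<le> (\<integral>\<^sup>+ z. f z \<partial>count_space A)"
      unfolding sup
    proof (rule SUP_least)
      fix F assume F: "F \<in> {F. finite F \<and> F \<subseteq> A}"
      then have "sum f F = (\<integral>\<^sup>+ z. f z * indicator F z \<partial>count_space A)"
        by (subst nn_integral_count_space'[where A = F]) (auto intro!: sum.cong)
      also have "\<dots> \<le> (\<integral>\<^sup>+ z. f z \<partial>count_space A)"
        by (intro nn_integral_mono) (auto split: split_indicator)
      finally show "sum f F \<le> (\<integral>\<^sup>+ z. f z \<partial>count_space A)" .
    qed
    let ?\<phi> = "from_nat_into A"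
    have bij: "bij_betw ?\<phi> UNIV A" using assms by (rule bij_betw_from_nat_into)
    have "(\<integral>\<^sup>+ z. f z \<partial>count_space A) = (\<Sum>i. f (?\<phi> i))"
      by (simp add: nn_integral_bij_count_space[OF bij, symmetric] nn_integral_count_space_nat)
    also have "\<dots> \<le> infsum f A"
      unfolding suminf_eq_SUP
    proof (rule SUP_least)
      fix n
      have "(\<Sum>i<n. f (?\<phi> i)) = sum f (?\<phi> ` {..<n})"
        using bij by (subst sum.reindex) (auto simp: bij_betw_def intro: inj_on_subset)
      also have "\<dots> \<le> infsum f A"
        unfolding sup using bij by (intro SUP_upper) (auto simp: bij_betw_def)
      finally show "(\<Sum>i<n. f (?\<phi> i)) \<le> infsum f A" .
    qed
    finally show "(\<integral>\<^sup>+ z. f z \<partial>count_space A) \<le> infsum f A" .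
  qed
qed

text \<open>The inequality \<open>\<le>\<close> is Bessel's inequality; for \<open>\<ge>\<close>, a trigonometric polynomial close to \<open>F\<close>
forces the Bessel defect for its own frequencies to be small. The factor \<open>1/b\<close> is the length of the
period, as the characters are not normalised.\<close>
theorem parseval_fourier:
  fixes F :: "real \<Rightarrow> complex"
  assumes b: "b > 0"
    and meas [measurable]: "F \<in> borel_measurable borel" and int: "integrable lborel (\<lambda>t. (cmod (F t))\<^sup>2)"
    and supp: "\<And>t. t \<notin> {x..x + 1/b} \<Longrightarrow> F t = 0"
  shows "(\<integral>\<^sup>+ l. ennreal ((cmod (LINT t|lborel. F t * cnj (fourier_char b l t)))\<^sup>2) \<partial>count_space UNIV)
     = ennreal (1/b) * (\<integral>\<^sup>+ t. ennreal ((cmod (F t))\<^sup>2) \<partial>lborel)"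
proof -
  define c where "c l = (LINT t|lborel. F t * cnj (fourier_char b l t))" for l
  define E where "E = (LINT t|lborel. (cmod (F t))\<^sup>2)"
  have dist: "(LINT t|lborel. (cmod (F t - indicator {x..x + 1/b} t * (\<Sum>l\<in>N. d l * fourier_char b l t)))\<^sup>2) =
    E - b * (\<Sum>l\<in>N. (cmod (c l))\<^sup>2) + (1/b) * (\<Sum>l\<in>N. (cmod (d l - of_real b * c l))\<^sup>2)"
    if "finite N" for N d
    unfolding c_def E_def by (rule trig_sum_distance) (use b meas int supp that in auto)
  have sup: "(\<integral>\<^sup>+ l. ennreal ((cmod (c l))\<^sup>2) \<partial>count_space UNIV) = 
    (SUP N\<in>{N. finite N \<and> N \<subseteq> UNIV}. \<Sum>l\<in>N. ennreal ((cmod (c l))\<^sup>2))"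
    by (subst infsum_eq_nn_integral_count_space[symmetric], simp, simp add: infinite_UNIV_int,
        rule nonneg_infsum_complete) simp
  have "(\<integral>\<^sup>+ l. ennreal ((cmod (c l))\<^sup>2) \<partial>count_space UNIV) = ennreal (E / b)"
  proof (rule antisym)
    show "(\<integral>\<^sup>+ l. ennreal ((cmod (c l))\<^sup>2) \<partial>count_space UNIV) \<le> ennreal (E / b)"
      unfolding sup
    proof (rule SUP_least)
      fix N :: "int set" assume "N \<in> {N. finite N \<and> N \<subseteq> UNIV}"
      then have N: "finite N" by simp
      have "0 \<le> E - b * (\<Sum>l\<in>N. (cmod (c l))\<^sup>2)"
        using dist[OF N, where d = "\<lambda>l. of_real b * c l"]
          Bochner_Integration.integral_nonneg[of lborel
            "\<lambda>t. (cmod (F t - indicator {x..x + 1/b} t * (\<Sum>l\<in>N. (of_real b * c l) * fourier_char b l t)))\<^sup>2"]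
        by simp
      then have "(\<Sum>l\<in>N. (cmod (c l))\<^sup>2) \<le> E / b" using b by (simp add: field_simps)
      then show "(\<Sum>l\<in>N. ennreal ((cmod (c l))\<^sup>2)) \<le> ennreal (E / b)"
        by (simp add: sum_ennreal ennreal_leI)
    qed
    show "ennreal (E / b) \<le> (\<integral>\<^sup>+ l. ennreal ((cmod (c l))\<^sup>2) \<partial>count_space UNIV)"
    proof (rule ennreal_le_epsilon)
      fix e :: real assume e: "0 < e"
      obtain T where T: "trig_poly b T"
        "(LINT t|lborel. (cmod (F t - indicator {x..x + 1/b} t * T t))\<^sup>2) < e * b"
        by (rule L2_approx_trig_poly[of b F x "e * b"]) (use b meas int supp e in auto)
      obtain N d where N: "finite N" and Td: "T = (\<lambda>t. \<Sum>l\<in>N. d l * fourier_char b l t)"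
        using trig_poly_obtain_sum[OF T(1)] .
      have "E - b * (\<Sum>l\<in>N. (cmod (c l))\<^sup>2) \<le> E - b * (\<Sum>l\<in>N. (cmod (c l))\<^sup>2) + (1/b) * (\<Sum>l\<in>N. (cmod (d l - of_real b * c l))\<^sup>2)"
        using b by (simp add: sum_nonneg)
      also have "\<dots> < e * b" using T(2) unfolding Td dist[OF N] .
      finally have "E / b \<le> (\<Sum>l\<in>N. (cmod (c l))\<^sup>2) + e" using b by (simp add: field_simps)
      then have "ennreal (E / b) \<le> ennreal ((\<Sum>l\<in>N. (cmod (c l))\<^sup>2) + e)" by (rule ennreal_leI)
      also have "\<dots> = (\<Sum>l\<in>N. ennreal ((cmod (c l))\<^sup>2)) + ennreal e"
        using e by (simp add: sum_ennreal sum_nonneg ennreal_plus)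
      also have "(\<Sum>l\<in>N. ennreal ((cmod (c l))\<^sup>2)) \<le> (\<integral>\<^sup>+ l. ennreal ((cmod (c l))\<^sup>2) \<partial>count_space UNIV)"
        unfolding sup using N by (intro SUP_upper) simp
      finally show "ennreal (E / b) \<le> (\<integral>\<^sup>+ l. ennreal ((cmod (c l))\<^sup>2) \<partial>count_space UNIV) + ennreal e"
        by (simp add: add_right_mono)
    qed
  qed
  also have "ennreal (E / b) = ennreal (1/b) * ennreal E"
    using b by (simp add: E_def flip: ennreal_mult)
  also have "ennreal E = (\<integral>\<^sup>+ t. ennreal ((cmod (F t))\<^sup>2) \<partial>lborel)"
    unfolding E_def using int by (simp add: nn_integral_eq_integral)
  finally show ?thesis unfolding c_def .
qed

section \<open>The frame operator of a window supported in one modulation period\<close>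

lemma gabor_sum_rect_lattice:
  assumes b: "b > 0" and a: "a > 0"
  shows "gabor_sum g (rect_lattice a b) f =
    (\<integral>\<^sup>+ k. \<integral>\<^sup>+ l. ennreal ((cmod (L2_inner f (tf_shift (a * of_int k, b * of_int l) g)))\<^sup>2)
      \<partial>count_space UNIV \<partial>count_space (UNIV :: int set))"
proof -
  define \<phi> where "\<phi> = (\<lambda>(k::int, l::int). (a * of_int k, b * of_int l))"
  let ?H = "\<lambda>z. ennreal ((cmod (L2_inner f (tf_shift z g)))\<^sup>2)"
  have inj: "inj \<phi>" using a b by (auto simp: \<phi>_def inj_on_def)
  have range: "rect_lattice a b = range \<phi>"
    by (auto simp: rect_lattice_def \<phi>_def image_iff)
  have "gabor_sum g (rect_lattice a b) f = infsum (?H \<circ> \<phi>) UNIV"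
    unfolding gabor_sum_def range by (rule infsum_reindex[OF inj])
  also have "\<dots> = (\<integral>\<^sup>+ z. (?H \<circ> \<phi>) z \<partial>count_space UNIV)"
    by (rule infsum_eq_nn_integral_count_space) (auto simp: finite_prod infinite_UNIV_int)
  also have "\<dots> = (\<integral>\<^sup>+ k. \<integral>\<^sup>+ l. (?H \<circ> \<phi>) (k, l) \<partial>count_space UNIV \<partial>count_space UNIV)"
    by (rule nn_integral_fst_count_space[symmetric])
  finally show ?thesis by (simp add: \<phi>_def)
qed

text \<open>Since \<open>g\<close> is supported in an interval of length \<open>1/b\<close>, Parseval's identity applies to each
\<open>f(t) * cnj (g(t - a k))\<close> on its own period interval, shifted by \<open>a k\<close>, and the
sum over \<open>k\<close> may be exchanged with the integral by monotone convergence. Boundedness of \<open>g\<close> keeps the products square integrable.\<close>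
theorem gabor_sum_painless:
  fixes g f :: "real \<Rightarrow> complex"
  assumes a: "a > 0" and b: "b > 0"
    and g [measurable]: "g \<in> borel_measurable borel" and bd: "\<And>t. cmod (g t) \<le> M"
    and supp: "\<And>t. t \<notin> {0..1/b} \<Longrightarrow> g t = 0" and f: "f \<in> L2"
  shows "gabor_sum g (rect_lattice a b) f =
    (\<integral>\<^sup>+ t. ennreal ((cmod (f t))\<^sup>2) *
       (ennreal (1/b) * (\<integral>\<^sup>+ k. ennreal ((cmod (g (t - a * of_int k)))\<^sup>2) \<partial>count_space (UNIV :: int set))) \<partial>lborel)"
proof -
  have [measurable]: "f \<in> borel_measurable borel" and fint: "integrable lborel (\<lambda>t. (cmod (f t))\<^sup>2)"
    using f by (auto simp: L2_def)
  define F where "F k t = f t * cnj (g (t - a * of_int k))" for k :: int and t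
  have [measurable]: "F k \<in> borel_measurable borel" for k
    unfolding F_def by measurable
  have Fint: "integrable lborel (\<lambda>t. (cmod (F k t))\<^sup>2)" for k
  proof (rule Bochner_Integration.integrable_bound)
    show "integrable lborel (\<lambda>t. M\<^sup>2 * (cmod (f t))\<^sup>2)" by (intro integrable_mult_right fint)
    show "AE t in lborel. norm ((cmod (F k t))\<^sup>2) \<le> norm (M\<^sup>2 * (cmod (f t))\<^sup>2)"
    proof (rule AE_I2)
      fix t
      have "(cmod (g (t - a * of_int k)))\<^sup>2 \<le> M\<^sup>2" by (intro power_mono bd) simp
      from mult_right_mono[OF this, of "(cmod (f t))\<^sup>2"]
      show "norm ((cmod (F k t))\<^sup>2) \<le> norm (M\<^sup>2 * (cmod (f t))\<^sup>2)"
        by (simp add: F_def norm_mult power_mult_distrib mult.commute)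
    qed
  qed simp
  have Fsupp: "F k t = 0" if "t \<notin> {a * of_int k..a * of_int k + 1/b}" for k t
    using that supp[of "t - a * of_int k"] by (auto simp: F_def)
  have inner: "L2_inner f (tf_shift (a * of_int k, b * of_int l) g) = (LINT t|lborel. F k t * cnj (fourier_char b l t))" for k l
    unfolding L2_inner_def tf_shift_def F_def fourier_char_def by (simp add: mult.assoc)
  have "gabor_sum g (rect_lattice a b) f =
      (\<integral>\<^sup>+ k. ennreal (1/b) * (\<integral>\<^sup>+ t. ennreal ((cmod (F k t))\<^sup>2) \<partial>lborel) \<partial>count_space UNIV)"
    unfolding gabor_sum_rect_lattice[OF b a] inner
    by (intro nn_integral_cong parseval_fourier[OF b _ Fint Fsupp]) simp_all
  also have "\<dots> = (\<integral>\<^sup>+ k. \<integral>\<^sup>+ t. ennreal (1/b) * ennreal ((cmod (F k t))\<^sup>2) \<partial>lborel \<partial>count_space UNIV)"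
    by (simp add: nn_integral_cmult)
  also have "\<dots> = (\<integral>\<^sup>+ t. \<integral>\<^sup>+ k. ennreal (1/b) * ennreal ((cmod (F k t))\<^sup>2) \<partial>count_space UNIV \<partial>lborel)"
    by (rule nn_integral_count_space_nn_integral[symmetric]) simp_all
  also have "\<dots> = (\<integral>\<^sup>+ t. ennreal ((cmod (f t))\<^sup>2) *
       (ennreal (1/b) * (\<integral>\<^sup>+ k. ennreal ((cmod (g (t - a * of_int k)))\<^sup>2) \<partial>count_space UNIV)) \<partial>lborel)"
  proof (rule nn_integral_cong)
    fix t
    have "(\<integral>\<^sup>+ k. ennreal (1/b) * ennreal ((cmod (F k t))\<^sup>2) \<partial>count_space UNIV) =
      (\<integral>\<^sup>+ k. (ennreal ((cmod (f t))\<^sup>2) * ennreal (1/b)) * ennreal ((cmod (g (t - a * of_int k)))\<^sup>2) \<partial>count_space UNIV)"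
      by (intro nn_integral_cong) (simp add: F_def norm_mult power_mult_distrib ennreal_mult mult_ac)
    also have "\<dots> = (ennreal ((cmod (f t))\<^sup>2) * ennreal (1/b)) *
        (\<integral>\<^sup>+ k. ennreal ((cmod (g (t - a * of_int k)))\<^sup>2) \<partial>count_space UNIV)"
      by (rule nn_integral_cmult) simp
    finally show "(\<integral>\<^sup>+ k. ennreal (1/b) * ennreal ((cmod (F k t))\<^sup>2) \<partial>count_space UNIV) =
      ennreal ((cmod (f t))\<^sup>2) *
       (ennreal (1/b) * (\<integral>\<^sup>+ k. ennreal ((cmod (g (t - a * of_int k)))\<^sup>2) \<partial>count_space UNIV))"
      by (simp add: mult.assoc)
  qed
  finally show ?thesis .
qed

section \<open>The weight of the one-sided exponential\<close>

lemma one_sided_exp_measurable [measurable]: "one_sided_exp b c \<gamma> \<in> borel_measurable borel"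
  unfolding one_sided_exp_def by measurable

lemma norm_sq_one_sided_exp:
  "(cmod (one_sided_exp b c \<gamma> t))\<^sup>2 = c\<^sup>2 * exp (- (2 * \<gamma> * t)) * indicator {0..1/b} t"
  by (auto simp: one_sided_exp_def norm_mult power_mult_distrib exp_double[symmetric] power2_eq_square
      exp_add[symmetric] algebra_simps split: split_indicator)

text \<open>For \<open>t\<close> off the lattice \<open>a\<int>\<close> with residue \<open>s\<close>, the translate by \<open>a k\<close> sees the point
\<open>s + a j\<close> of the window, where \<open>j = \<lfloor>t / a\<rfloor> - k\<close>. This lies in \<open>[0, n a]\<close> precisely for \<open>j = 0, \<dots>, n - 1\<close>.
At lattice points both ends of the window would contribute, giving \<open>n + 1\<close> terms.\<close>
lemma periodized_one_sided_exp:
  fixes a b c \<gamma> t :: real and n :: nat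
  assumes a: "a > 0" and nab: "1 / b = real n * a" and t: "t / a \<notin> \<int>"
  defines "s \<equiv> t - a * of_int \<lfloor>t / a\<rfloor>"
  shows "(\<integral>\<^sup>+ k. ennreal ((cmod (one_sided_exp b c \<gamma> (t - a * of_int k)))\<^sup>2) \<partial>count_space (UNIV :: int set))
    = ennreal (c\<^sup>2 * exp (- (2 * \<gamma> * s)) * (\<Sum>j<n. exp (- (2 * a * \<gamma>)) ^ j))"
proof -
  define m where "m = \<lfloor>t / a\<rfloor>"
  have ts: "t = a * of_int m + s" by (simp add: s_def m_def)
  have s: "0 < s" "s < a"
  proof -
    have "of_int m \<noteq> t / a" using t by (metis Ints_of_int)
    then have "of_int m < t / a" using of_int_floor_le[of "t / a"] by (simp add: m_def less_le)
    then show "0 < s" using a by (simp add: s_def m_def[symmetric] field_simps)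
    have "t / a < of_int m + 1" unfolding m_def by linarith
    then show "s < a" using a by (simp add: s_def m_def[symmetric] field_simps)
  qed
  let ?h = "\<lambda>k. ennreal ((cmod (one_sided_exp b c \<gamma> (t - a * of_int k)))\<^sup>2)"
  let ?\<kappa> = "\<lambda>j::nat. m - int j"
  have shift: "t - a * of_int (m - j) = s + a * of_int j" for j
    unfolding ts by (simp add: algebra_simps)
  have zero: "?h k = 0" if k: "k \<notin> ?\<kappa> ` {..<n}" for k
  proof -
    define j where "j = m - k"
    have "j < 0 \<or> j \<ge> int n"
    proof (rule ccontr)
      assume "\<not> ?thesis"
      then have "k = ?\<kappa> (nat j)" "nat j < n" by (auto simp: j_def)
      then show False using k by blast
    qed
    moreover have "s + a * of_int j < 0" if "j < 0"
    proof -
      have "a * of_int j \<le> a * (- 1)" using that a by (intro mult_left_mono) auto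
      then show ?thesis using s by simp
    qed
    moreover have "s + a * of_int j > real n * a" if "j \<ge> int n"
    proof -
      have "a * of_int j \<ge> a * real n" using that a by (intro mult_left_mono) auto
      then show ?thesis using s unfolding mult.commute[of "real n" a] by linarith
    qed
    ultimately have "s + a * of_int j \<notin> {0..1/b}" unfolding nab by auto
    moreover have "t - a * of_int k = s + a * of_int j" using shift[of j] by (simp add: j_def)
    ultimately show ?thesis unfolding norm_sq_one_sided_exp by simp
  qed
  have val: "?h (?\<kappa> j) = ennreal (c\<^sup>2 * exp (- (2 * \<gamma> * s)) * exp (- (2 * a * \<gamma>)) ^ j)" if "j < n" for j
  proof -
    have "a * real j \<le> a * (real n - 1)" using that a by (intro mult_left_mono) auto
    then have "s + a * real j \<in> {0..1/b}" unfolding nab using s a by (auto simp: algebra_simps)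
    moreover have "exp (- (2 * \<gamma> * (s + a * real j))) = exp (- (2 * \<gamma> * s)) * exp (- (2 * a * \<gamma>)) ^ j"
      by (simp add: exp_of_nat_mult[symmetric] exp_add[symmetric] algebra_simps)
    ultimately show ?thesis
      unfolding shift norm_sq_one_sided_exp by (simp add: mult.assoc)
  qed
  have "(\<integral>\<^sup>+ k. ?h k \<partial>count_space UNIV) = (\<Sum>k\<in>?\<kappa> ` {..<n}. ?h k)"
    by (rule nn_integral_count_space') (use zero in auto)
  also have "\<dots> = (\<Sum>j<n. ?h (?\<kappa> j))"
    by (subst sum.reindex) (auto simp: inj_on_def)
  also have "\<dots> = (\<Sum>j<n. ennreal (c\<^sup>2 * exp (- (2 * \<gamma> * s)) * exp (- (2 * a * \<gamma>)) ^ j))"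
    by (intro sum.cong val) auto
  also have "\<dots> = ennreal (c\<^sup>2 * exp (- (2 * \<gamma> * s)) * (\<Sum>j<n. exp (- (2 * a * \<gamma>)) ^ j))"
    by (subst sum_ennreal) (auto simp: sum_distrib_left)
  finally show ?thesis .
qed

lemma L2_norm_sq_one_sided_exp:
  assumes b: "b > 0" and \<gamma>: "\<gamma> > 0"
  shows "(L2_norm (one_sided_exp b c \<gamma>))\<^sup>2 = c\<^sup>2 * (1 - exp (- (2 * \<gamma> / b))) / (2 * \<gamma>)"
proof -
  have "(LINT t|lborel. (cmod (one_sided_exp b c \<gamma> t))\<^sup>2) =
      (LINT t|lborel. indicator {0..1/b} t *\<^sub>R (c\<^sup>2 * exp (- (2 * \<gamma> * t))))"
    by (simp add: norm_sq_one_sided_exp mult_ac)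
  also have "\<dots> = - c\<^sup>2 * exp (- (2 * \<gamma> * (1/b))) / (2 * \<gamma>) - (- c\<^sup>2 * exp (- (2 * \<gamma> * 0)) / (2 * \<gamma>))"
  proof (rule integral_FTC_Icc)
    fix t
    show "((\<lambda>t. - c\<^sup>2 * exp (- (2 * \<gamma> * t)) / (2 * \<gamma>)) has_vector_derivative c\<^sup>2 * exp (- (2 * \<gamma> * t))) (at t within {0..1/b})"
      unfolding has_real_derivative_iff_has_vector_derivative[symmetric]
      using \<gamma> by (auto intro!: derivative_eq_intros)
  qed (use b in \<open>auto intro!: continuous_intros\<close>)
  also have "\<dots> = c\<^sup>2 * (1 - exp (- (2 * \<gamma> / b))) / (2 * \<gamma>)"
    by (simp add: algebra_simps diff_divide_distrib)
  finally have "(LINT t|lborel. (cmod (one_sided_exp b c \<gamma> t))\<^sup>2) = c\<^sup>2 * (1 - exp (- (2 * \<gamma> / b))) / (2 * \<gamma>)" .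
  moreover have "(LINT t|lborel. (cmod (one_sided_exp b c \<gamma> t))\<^sup>2) \<ge> 0" by simp
  ultimately show ?thesis by (simp add: L2_norm_def)
qed

text \<open>The geometric sum over \<open>n\<close> translates has numerator \<open>1 - exp (-2a\<gamma>n) = 1 - exp (-2\<gamma>/b)\<close>, which is
also the factor in the squared norm of the window; normalisation therefore removes it.\<close>
lemma gabor_sum_one_sided_exp:
  assumes a: "a > 0" and b: "b > 0" and nab: "1 / b = real n * a" and \<gamma>: "\<gamma> > 0"
    and norm1: "L2_norm (one_sided_exp b c \<gamma>) = 1" and f: "f \<in> L2"
  shows "gabor_sum (one_sided_exp b c \<gamma>) (rect_lattice a b) f =
    (\<integral>\<^sup>+ t. ennreal ((cmod (f t))\<^sup>2) *
       ennreal (2 * a * \<gamma> * real n / (1 - exp (- (2 * a * \<gamma>))) * exp (- (2 * \<gamma> * (t - a * of_int \<lfloor>t / a\<rfloor>)))) \<partial>lborel)"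
proof -
  let ?g = "one_sided_exp b c \<gamma>"
  define q where "q = exp (- (2 * a * \<gamma>))"
  have q: "q < 1" using a \<gamma> by (simp add: q_def)
  have "q ^ n = exp (- (2 * \<gamma> / b))"
    using nab by (simp add: q_def exp_of_nat_mult[symmetric] divide_inverse mult_ac)
  then have c: "c\<^sup>2 * (1 - q ^ n) = 2 * \<gamma>"
    using L2_norm_sq_one_sided_exp[OF b \<gamma>, of c] norm1 \<gamma> by (simp add: field_simps)
  have weight: "1/b * (c\<^sup>2 * E * (\<Sum>j<n. q ^ j)) = 2 * a * \<gamma> * real n / (1 - q) * E" for E
  proof -
    have "1/b * (c\<^sup>2 * E * (\<Sum>j<n. q ^ j)) = real n * a * E * (c\<^sup>2 * (1 - q ^ n)) / (1 - q)"
      using q by (simp add: nab geometric_sum field_simps)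
    then show ?thesis unfolding c by (simp add: mult_ac)
  qed
  have bound: "cmod (?g t) \<le> \<bar>c\<bar>" for t
    using \<gamma> by (auto simp: one_sided_exp_def norm_mult mult_left_le split: split_indicator)
  have supp: "?g t = 0" if "t \<notin> {0..1/b}" for t
    using that by (simp add: one_sided_exp_def)
  have nonlattice: "AE t in lborel. t / a \<notin> \<int>"
  proof -
    have "{t. t / a \<in> \<int>} \<subseteq> range (\<lambda>k::int. a * of_int k)"
      using a by (force elim!: Ints_cases simp: field_simps)
    then have "countable {t. t / a \<in> \<int>}" by (rule countable_subset) simp
    then have "{t. t / a \<in> \<int>} \<in> null_sets lborel" by (rule countable_imp_null_set_lborel)
    from AE_not_in[OF this] show ?thesis by simp
  qed
  have "gabor_sum ?g (rect_lattice a b) f =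
    (\<integral>\<^sup>+ t. ennreal ((cmod (f t))\<^sup>2) *
       (ennreal (1/b) * (\<integral>\<^sup>+ k. ennreal ((cmod (?g (t - a * of_int k)))\<^sup>2) \<partial>count_space (UNIV :: int set))) \<partial>lborel)"
    by (rule gabor_sum_painless[where M = "\<bar>c\<bar>"]) (use a b bound supp f in auto)
  also have "\<dots> = (\<integral>\<^sup>+ t. ennreal ((cmod (f t))\<^sup>2) *
       ennreal (2 * a * \<gamma> * real n / (1 - q) * exp (- (2 * \<gamma> * (t - a * of_int \<lfloor>t / a\<rfloor>)))) \<partial>lborel)"
  proof (rule nn_integral_cong_AE, rule eventually_mono[OF nonlattice])
    fix t assume t: "t / a \<notin> \<int>"
    show "ennreal ((cmod (f t))\<^sup>2) *
        (ennreal (1/b) * (\<integral>\<^sup>+ k. ennreal ((cmod (?g (t - a * of_int k)))\<^sup>2) \<partial>count_space UNIV)) =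
      ennreal ((cmod (f t))\<^sup>2) *
        ennreal (2 * a * \<gamma> * real n / (1 - q) * exp (- (2 * \<gamma> * (t - a * of_int \<lfloor>t / a\<rfloor>))))"
      unfolding periodized_one_sided_exp[OF a nab t] q_def[symmetric] weight[symmetric]
      using b by (subst ennreal_mult'[symmetric]) simp_all
  qed
  finally show ?thesis unfolding q_def .
qed

section \<open>Sharp bounds for multiplication operators\<close>

lemma indicator_L2:
  assumes "p \<le> q"
  shows "(\<lambda>t. complex_of_real (indicator {p..q} t)) \<in> L2"
    and "(L2_norm (\<lambda>t. complex_of_real (indicator {p..q} t)))\<^sup>2 = q - p"
proof -
  have sq: "(cmod (complex_of_real (indicator {p..q} t)))\<^sup>2 = indicator {p..q} t" for t
    by (simp split: split_indicator)
  show "(\<lambda>t. complex_of_real (indicator {p..q} t)) \<in> L2"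
    unfolding L2_def mem_Collect_eq sq by simp
  show "(L2_norm (\<lambda>t. complex_of_real (indicator {p..q} t)))\<^sup>2 = q - p"
    unfolding L2_norm_def sq using assms by simp
qed

lemma constant_multiplier_nn_integral:
  assumes f: "f \<in> L2" and C: "0 \<le> C"
  shows "(\<integral>\<^sup>+ t. ennreal ((cmod (f t))\<^sup>2) * ennreal C \<partial>lborel) = ennreal (C * (L2_norm f)\<^sup>2)"
proof -
  have int: "integrable lborel (\<lambda>t. (cmod (f t))\<^sup>2)" and [measurable]: "f \<in> borel_measurable borel"
    using f by (auto simp: L2_def)
  have "(\<integral>\<^sup>+ t. ennreal ((cmod (f t))\<^sup>2) * ennreal C \<partial>lborel) = (\<integral>\<^sup>+ t. ennreal ((cmod (f t))\<^sup>2) \<partial>lborel) * ennreal C"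
    by (rule nn_integral_multc) simp
  also have "(\<integral>\<^sup>+ t. ennreal ((cmod (f t))\<^sup>2) \<partial>lborel) = ennreal (LINT t|lborel. (cmod (f t))\<^sup>2)"
    using int by (simp add: nn_integral_eq_integral)
  also have "(LINT t|lborel. (cmod (f t))\<^sup>2) = (L2_norm f)\<^sup>2"
    by (simp add: L2_norm_def)
  finally show ?thesis using C by (simp add: ennreal_mult mult.commute)
qed

lemma multiplier_le:
  assumes f: "f \<in> L2" and C: "0 \<le> C" and le: "AE t in lborel. f t \<noteq> 0 \<longrightarrow> w t \<le> C"
  shows "(\<integral>\<^sup>+ t. ennreal ((cmod (f t))\<^sup>2) * ennreal (w t) \<partial>lborel) \<le> ennreal (C * (L2_norm f)\<^sup>2)"
  unfolding constant_multiplier_nn_integral[OF f C, symmetric]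
  using le by (intro nn_integral_mono_AE, eventually_elim) (auto intro: mult_left_mono ennreal_leI)

lemma multiplier_ge:
  assumes f: "f \<in> L2" and C: "0 \<le> C" and ge: "AE t in lborel. f t \<noteq> 0 \<longrightarrow> C \<le> w t"
  shows "ennreal (C * (L2_norm f)\<^sup>2) \<le> (\<integral>\<^sup>+ t. ennreal ((cmod (f t))\<^sup>2) * ennreal (w t) \<partial>lborel)"
  unfolding constant_multiplier_nn_integral[OF f C, symmetric]
  using ge by (intro nn_integral_mono_AE, eventually_elim) (auto intro: mult_left_mono ennreal_leI)

text \<open>When the frame operator is multiplication by \<open>w\<close>, its quadratic form is bounded below by the
essential infimum of \<open>w\<close>, and indicator functions of short intervals on which \<open>w\<close> is nearly minimal
show that nothing larger works. The assumption \<open>near\<close> asks for intervals because the weight of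
interest is piecewise continuous and its infimum is approached but not attained on a set of positive
measure.\<close>
lemma sharp_lower_frame_bound_multiplier:
  assumes rep: "\<And>f. f \<in> L2 \<Longrightarrow> gabor_sum g \<Lambda> f = (\<integral>\<^sup>+ t. ennreal ((cmod (f t))\<^sup>2) * ennreal (w t) \<partial>lborel)"
    and A: "0 \<le> A" and ge: "AE t in lborel. A \<le> w t"
    and near: "\<And>C. A < C \<Longrightarrow> \<exists>p q. p < q \<and> (AE t in lborel. t \<in> {p..q} \<longrightarrow> w t \<le> C)"
  shows "sharp_lower_frame_bound g \<Lambda> = A"
  unfolding sharp_lower_frame_bound_def
proof (rule Greatest_equality)
  show "is_lower_frame_bound g \<Lambda> A"
    unfolding is_lower_frame_bound_def using A ge by (auto simp: rep intro!: multiplier_ge)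
next
  fix A' assume A': "is_lower_frame_bound g \<Lambda> A'"
  show "A' \<le> A"
  proof (rule dense_ge)
    fix C assume C: "A < C"
    then obtain p q where pq: "p < q" "AE t in lborel. t \<in> {p..q} \<longrightarrow> w t \<le> C"
      using near by blast
    let ?f = "\<lambda>t. complex_of_real (indicator {p..q} t)"
    have f: "?f \<in> L2" "(L2_norm ?f)\<^sup>2 = q - p"
      using indicator_L2[of p q] pq(1) by auto
    have "ennreal (A' * (q - p)) \<le> gabor_sum g \<Lambda> ?f"
      using A' f unfolding is_lower_frame_bound_def by metis
    also have "\<dots> \<le> ennreal (C * (q - p))"
      unfolding rep[OF f(1)] f(2)[symmetric]
      using pq(2) A C by (intro multiplier_le f(1)) (auto split: split_indicator)
    finally have "A' * (q - p) \<le> C * (q - p)"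
      using pq(1) A C by (subst (asm) ennreal_le_iff) auto
    then show "A' \<le> C" using pq(1) by simp
  qed
qed

lemma sharp_upper_frame_bound_multiplier:
  assumes rep: "\<And>f. f \<in> L2 \<Longrightarrow> gabor_sum g \<Lambda> f = (\<integral>\<^sup>+ t. ennreal ((cmod (f t))\<^sup>2) * ennreal (w t) \<partial>lborel)"
    and B: "0 \<le> B" and le: "AE t in lborel. w t \<le> B"
    and near: "\<And>C. C < B \<Longrightarrow> \<exists>p q. p < q \<and> (AE t in lborel. t \<in> {p..q} \<longrightarrow> C \<le> w t)"
  shows "sharp_upper_frame_bound g \<Lambda> = B"
  unfolding sharp_upper_frame_bound_def
proof (rule Least_equality)
  show "is_upper_frame_bound g \<Lambda> B"
    unfolding is_upper_frame_bound_def using B le by (auto simp: rep intro!: multiplier_le)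
next
  fix B' assume B': "is_upper_frame_bound g \<Lambda> B'"
  then have B'0: "0 \<le> B'" by (simp add: is_upper_frame_bound_def)
  show "B \<le> B'"
  proof (rule dense_le)
    fix C assume C: "C < B"
    show "C \<le> B'"
    proof (cases "0 \<le> C")
      case False
      then show ?thesis using B'0 by simp
    next
      case True
      obtain p q where pq: "p < q" "AE t in lborel. t \<in> {p..q} \<longrightarrow> C \<le> w t"
        using near C by blast
      let ?f = "\<lambda>t. complex_of_real (indicator {p..q} t)"
      have f: "?f \<in> L2" "(L2_norm ?f)\<^sup>2 = q - p"
        using indicator_L2[of p q] pq(1) by auto
      have "ennreal (C * (q - p)) \<le> gabor_sum g \<Lambda> ?f"
        unfolding rep[OF f(1)] f(2)[symmetric]
        using pq(2) True by (intro multiplier_ge f(1)) (auto split: split_indicator)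
      also have "\<dots> \<le> ennreal (B' * (q - p))"
        using B' f unfolding is_upper_frame_bound_def by metis
      finally have "C * (q - p) \<le> B' * (q - p)"
        using pq(1) B'0 by (subst (asm) ennreal_le_iff) auto
      then show ?thesis using pq(1) by simp
    qed
  qed
qed

text \<open>The weight decreases from \<open>K\<close> to \<open>K * exp (-2\<gamma>a)\<close> on each period \<open>(0, a)\<close>. The test intervals
for the upper bound therefore shrink towards the left end of the period, those for the lower bound
towards its right end.\<close>
lemma sharp_frame_bounds_one_sided_exp:
  fixes a b c \<gamma> :: real and n :: nat
  assumes a: "a > 0" and b: "b > 0" and nab: "1 / b = real n * a" and \<gamma>: "\<gamma> > 0"
    and norm1: "L2_norm (one_sided_exp b c \<gamma>) = 1"
  shows "sharp_lower_frame_bound (one_sided_exp b c \<gamma>) (rect_lattice a b) = real n * (2 * a * \<gamma> / (exp (2 * a * \<gamma>) - 1))"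
    and "sharp_upper_frame_bound (one_sided_exp b c \<gamma>) (rect_lattice a b) = real n * (2 * a * \<gamma> / (1 - exp (- (2 * a * \<gamma>))))"
proof -
  define K where "K = 2 * a * \<gamma> * real n / (1 - exp (- (2 * a * \<gamma>)))"
  define w where "w t = K * exp (- (2 * \<gamma> * (t - a * of_int \<lfloor>t / a\<rfloor>)))" for t
  have K: "0 \<le> K" using a \<gamma> by (simp add: K_def)
  have KA: "0 \<le> K * exp (- (2 * \<gamma> * a))" using K by simp
  note rep = gabor_sum_one_sided_exp[OF a b nab \<gamma> norm1, folded K_def w_def]
  have frac: "0 \<le> t - a * of_int \<lfloor>t / a\<rfloor>" "t - a * of_int \<lfloor>t / a\<rfloor> \<le> a" for t
    using floor_divide_lower[OF a, of t] floor_divide_upper[OF a, of t] by (simp_all add: algebra_simps)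
  have w_period: "w t = K * exp (- (2 * \<gamma> * t))" if "0 \<le> t" "t < a" for t
  proof -
    have "\<lfloor>t / a\<rfloor> = 0" using that a by (simp add: floor_eq_iff)
    then show ?thesis by (simp add: w_def)
  qed
  have mono: "K * exp (- (2 * \<gamma> * v)) \<le> K * exp (- (2 * \<gamma> * u))" if "u \<le> v" for u v
    using that K \<gamma> by (intro mult_left_mono) auto
  have "sharp_lower_frame_bound (one_sided_exp b c \<gamma>) (rect_lattice a b) = K * exp (- (2 * \<gamma> * a))"
  proof (rule sharp_lower_frame_bound_multiplier[OF rep KA])
    show "AE t in lborel. K * exp (- (2 * \<gamma> * a)) \<le> w t"
      unfolding w_def using mono frac(2) by auto
    fix C assume C: "K * exp (- (2 * \<gamma> * a)) < C"
    have "((\<lambda>u. K * exp (- (2 * \<gamma> * u))) \<longlongrightarrow> K * exp (- (2 * \<gamma> * a))) (at_left a)"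
      by (intro tendsto_intros)
    from order_tendstoD(2)[OF this C] eventually_at_left_real[OF a]
    have "eventually (\<lambda>u. K * exp (- (2 * \<gamma> * u)) < C \<and> u \<in> {0<..<a}) (at_left a)"
      by (rule eventually_conj)
    from eventually_happens[OF this] obtain u where u: "K * exp (- (2 * \<gamma> * u)) < C" "0 < u" "u < a"
      by auto
    have "AE t in lborel. t \<in> {u..a} \<longrightarrow> w t \<le> C"
      using AE_lborel_singleton[of a]
    proof eventually_elim
      case (elim t)
      show ?case
      proof
        assume "t \<in> {u..a}"
        then have "w t = K * exp (- (2 * \<gamma> * t))" "u \<le> t" using u elim by (auto intro: w_period)
        then show "w t \<le> C" using mono[of u t] u(1) by simp
      qed
    qed
    then show "\<exists>p q. p < q \<and> (AE t in lborel. t \<in> {p..q} \<longrightarrow> w t \<le> C)" using u(3) by blast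
  qed
  moreover have "K * exp (- (2 * \<gamma> * a)) = real n * (2 * a * \<gamma> / (exp (2 * a * \<gamma>) - 1))"
    using a \<gamma> by (simp add: K_def exp_minus field_simps)
  ultimately show "sharp_lower_frame_bound (one_sided_exp b c \<gamma>) (rect_lattice a b) = real n * (2 * a * \<gamma> / (exp (2 * a * \<gamma>) - 1))"
    by simp
  have "sharp_upper_frame_bound (one_sided_exp b c \<gamma>) (rect_lattice a b) = K"
  proof (rule sharp_upper_frame_bound_multiplier[OF rep K])
    show "AE t in lborel. w t \<le> K"
      unfolding w_def using mono[of 0] frac(1) by auto
    fix C assume C: "C < K"
    have "((\<lambda>u. K * exp (- (2 * \<gamma> * u))) \<longlongrightarrow> K * exp (- (2 * \<gamma> * 0))) (at_right 0)"
      by (intro tendsto_intros)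
    from order_tendstoD(1)[OF this, of C] C eventually_at_right_real[OF a]
    have "eventually (\<lambda>u. C < K * exp (- (2 * \<gamma> * u)) \<and> u \<in> {0<..<a}) (at_right 0)"
      by (auto intro: eventually_conj)
    from eventually_happens[OF this] obtain u where u: "C < K * exp (- (2 * \<gamma> * u))" "0 < u" "u < a"
      by auto
    have "C \<le> w t" if "t \<in> {0..u}" for t
      using that u mono[of t u] w_period[of t] by auto
    then show "\<exists>p q. p < q \<and> (AE t in lborel. t \<in> {p..q} \<longrightarrow> C \<le> w t)"
      using u(2) by (intro exI[of _ 0] exI[of _ u]) auto
  qed
  then show "sharp_upper_frame_bound (one_sided_exp b c \<gamma>) (rect_lattice a b) = real n * (2 * a * \<gamma> / (1 - exp (- (2 * a * \<gamma>))))"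
    by (simp add: K_def)
qed

section \<open>Monotonicity of the two bounds\<close>

text \<open>Strictness comes from squaring the tangent inequality at \<open>x/2\<close>: the square \<open>(1 + x/2)\<^sup>2\<close> exceeds
\<open>1 + x\<close> by \<open>x\<^sup>2/4\<close>. Squaring is legitimate for \<open>x \<ge> -2\<close>; below that, \<open>1 + x\<close> is negative.\<close>
lemma exp_greater_tangent:
  fixes x :: real
  assumes x: "x \<noteq> 0"
  shows "1 + x < exp x"
proof (cases "1 + x / 2 \<ge> 0")
  case True
  have "1 + x < (1 + x / 2)\<^sup>2"
    using x by (simp add: power2_sum power_divide)
  also have "\<dots> \<le> (exp (x / 2))\<^sup>2"
    using True by (intro power_mono exp_ge_add_one_self)
  also have "\<dots> = exp x" by (simp flip: exp_double)
  finally show ?thesis .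
next
  case False
  then show ?thesis using exp_gt_zero[of x] by linarith
qed

text \<open>The numerator of the derivative is \<open>exp x * (1 - x) - 1\<close>, which is negative by the tangent inequality
at \<open>-x\<close>.\<close>
lemma lower_bound_profile:
  fixes x :: real
  assumes x: "x > 0"
  shows "x / (exp x - 1) < 1"
    and "\<exists>D<0. ((\<lambda>x. x / (exp x - 1)) has_real_derivative D) (at x)"
proof -
  have e: "1 + x < exp x" using x by (intro exp_greater_tangent) simp
  then show "x / (exp x - 1) < 1" using x by (simp add: divide_less_eq)
  have "(1 - x) * exp x < exp (- x) * exp x"
    using exp_greater_tangent[of "- x"] x by (intro mult_strict_right_mono) simp_all
  then have num: "exp x - 1 - x * exp x < 0"
    by (simp add: algebra_simps flip: exp_add)
  have "((\<lambda>x. x / (exp x - 1)) has_real_derivative (exp x - 1 - x * exp x) / (exp x - 1)\<^sup>2) (at x)"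
    using x by (auto intro!: derivative_eq_intros simp: power2_eq_square)
  moreover have "(exp x - 1 - x * exp x) / (exp x - 1)\<^sup>2 < 0"
    using num x by (intro divide_neg_pos) auto
  ultimately show "\<exists>D<0. ((\<lambda>x. x / (exp x - 1)) has_real_derivative D) (at x)" by blast
qed

text \<open>The numerator of the derivative is \<open>1 - exp (-x) * (1 + x)\<close>, which is positive by the tangent inequality
at \<open>x\<close>.\<close>
lemma upper_bound_profile:
  fixes x :: real
  assumes x: "x > 0"
  shows "1 < x / (1 - exp (- x))"
    and "\<exists>D>0. ((\<lambda>x. x / (1 - exp (- x))) has_real_derivative D) (at x)"
proof -
  have e: "1 - x < exp (- x)" using x exp_greater_tangent[of "- x"] by simp
  then show "1 < x / (1 - exp (- x))" using x by (simp add: less_divide_eq)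
  have "(1 + x) * exp (- x) < exp x * exp (- x)"
    using exp_greater_tangent[of x] x by (intro mult_strict_right_mono) simp_all
  then have num: "0 < 1 - exp (- x) - x * exp (- x)"
    by (simp add: algebra_simps flip: exp_add)
  have "((\<lambda>x. x / (1 - exp (- x))) has_real_derivative (1 - exp (- x) - x * exp (- x)) / (1 - exp (- x))\<^sup>2) (at x)"
    using x by (auto intro!: derivative_eq_intros simp: power2_eq_square)
  moreover have "0 < (1 - exp (- x) - x * exp (- x)) / (1 - exp (- x))\<^sup>2"
    using num x by (intro divide_pos_pos) auto
  ultimately show "\<exists>D>0. ((\<lambda>x. x / (1 - exp (- x))) has_real_derivative D) (at x)" by blast
qed

text \<open>The frame bounds are given by a formula only for positive parameters, so the derivative is
transferred along equality on the open half-line.\<close>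
lemma rescaled_profile_derivative:
  fixes \<phi> F :: "real \<Rightarrow> real"
  assumes \<phi>: "(\<phi> has_real_derivative D) (at (c * \<gamma>))" and \<gamma>: "\<gamma> > 0"
    and F: "\<And>y. y > 0 \<Longrightarrow> F y = r * \<phi> (c * y)"
  shows "(F has_real_derivative r * (c * D)) (at \<gamma>)"
proof -
  have "((\<lambda>y. c * y) has_real_derivative c) (at \<gamma>)"
    by (auto intro!: derivative_eq_intros)
  from DERIV_chain2[OF \<phi> this] have "((\<lambda>y. r * \<phi> (c * y)) has_real_derivative r * (D * c)) (at \<gamma>)"
    by (rule DERIV_cmult)
  then have "(F has_real_derivative r * (D * c)) (at \<gamma>)"
  proof (rule has_field_derivative_transform_within_open[of _ _ _ "{0<..}"])
    show "r * \<phi> (c * y) = F y" if "y \<in> {0<..}" for y using F[of y] that by simp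
  qed (use \<gamma> in auto)
  then show ?thesis by (simp add: mult.commute)
qed

theorem proposition2p3:
  fixes a b :: real and n :: nat
    and C A B :: "real \<Rightarrow> real" and g1 :: "real \<Rightarrow> real \<Rightarrow> complex"
  assumes "a > 0" and "b > 0" and "n \<ge> 1" and "inverse (a * b) = real n"
    and "\<And>\<gamma>. \<gamma> > 0 \<Longrightarrow> g1 \<gamma> = one_sided_exp b (C \<gamma>) \<gamma>"
    and "\<And>\<gamma>. \<gamma> > 0 \<Longrightarrow> C \<gamma> > 0"
    and "\<And>\<gamma>. \<gamma> > 0 \<Longrightarrow> L2_norm (g1 \<gamma>) = 1"
    and "\<And>\<gamma>. \<gamma> > 0 \<Longrightarrow> A \<gamma> = sharp_lower_frame_bound (g1 \<gamma>) (rect_lattice a b)"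
    and "\<And>\<gamma>. \<gamma> > 0 \<Longrightarrow> B \<gamma> = sharp_upper_frame_bound (g1 \<gamma>) (rect_lattice a b)"
  shows "\<forall>\<gamma>>0.
      A \<gamma> < real n \<and> A differentiable (at \<gamma>) \<and> deriv A \<gamma> < 0 \<and>
      B \<gamma> > real n \<and> B differentiable (at \<gamma>) \<and> deriv B \<gamma> > 0 \<and>
      frame_condition_number (g1 \<gamma>) (rect_lattice a b) = B \<gamma> / A \<gamma> \<and>
      B \<gamma> / A \<gamma> = exp (2 * a * \<gamma>)"
proof (intro allI impI)
  fix \<gamma> :: real assume \<gamma>: "0 < \<gamma>"
  have nab: "1 / b = real n * a"
    using assms(1,2,4) by (simp add: field_simps)
  have n: "real n > 0" using \<open>n \<ge> 1\<close> by simp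
  have A: "A y = real n * (2 * a * y / (exp (2 * a * y) - 1))" if "y > 0" for y
    using sharp_frame_bounds_one_sided_exp(1)[OF assms(1,2) nab that, of "C y"] assms(5,7,8)[OF that] by simp
  have B: "B y = real n * (2 * a * y / (1 - exp (- (2 * a * y))))" if "y > 0" for y
    using sharp_frame_bounds_one_sided_exp(2)[OF assms(1,2) nab that, of "C y"] assms(5,7,9)[OF that] by simp
  define x where "x = 2 * a * \<gamma>"
  have x: "x > 0" using \<gamma> \<open>a > 0\<close> by (simp add: x_def)
  obtain D where D: "D < 0" "((\<lambda>x. x / (exp x - 1)) has_real_derivative D) (at x)"
    using lower_bound_profile(2)[OF x] by blast
  have A': "(A has_real_derivative real n * (2 * a * D)) (at \<gamma>)"
    using rescaled_profile_derivative[OF D(2)[unfolded x_def] \<gamma>] A by blast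
  obtain E where E: "E > 0" "((\<lambda>x. x / (1 - exp (- x))) has_real_derivative E) (at x)"
    using upper_bound_profile(2)[OF x] by blast
  have B': "(B has_real_derivative real n * (2 * a * E)) (at \<gamma>)"
    using rescaled_profile_derivative[OF E(2)[unfolded x_def] \<gamma>] B by blast
  have "A \<gamma> < real n" "B \<gamma> > real n"
    using mult_strict_left_mono[OF lower_bound_profile(1)[OF x] n]
      mult_strict_left_mono[OF upper_bound_profile(1)[OF x] n] A[OF \<gamma>] B[OF \<gamma>]
    by (simp_all add: x_def)
  moreover have "A differentiable (at \<gamma>)" "B differentiable (at \<gamma>)"
    using A' B' by (auto simp: real_differentiable_def)
  moreover have "deriv A \<gamma> < 0" "deriv B \<gamma> > 0"
    using D(1) E(1) n \<open>a > 0\<close>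
    by (simp_all add: DERIV_imp_deriv[OF A'] DERIV_imp_deriv[OF B'] mult_pos_neg)
  moreover have "frame_condition_number (g1 \<gamma>) (rect_lattice a b) = B \<gamma> / A \<gamma>"
    using assms(8,9)[OF \<gamma>] by (simp add: frame_condition_number_def)
  moreover have "B \<gamma> / A \<gamma> = exp (2 * a * \<gamma>)"
  proof -
    have "B \<gamma> / A \<gamma> = (exp x - 1) / (1 - exp (- x))"
      using x n unfolding A[OF \<gamma>] B[OF \<gamma>] x_def[symmetric] by simp
    also have "exp x - 1 = exp x * (1 - exp (- x))"
      by (simp add: right_diff_distrib flip: exp_add)
    finally show ?thesis using x \<gamma> \<open>a > 0\<close> by (simp add: x_def)
  qed
  ultimately show "A \<gamma> < real n \<and> A differentiable (at \<gamma>) \<and> deriv A \<gamma> < 0 \<and>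
      B \<gamma> > real n \<and> B differentiable (at \<gamma>) \<and> deriv B \<gamma> > 0 \<and>
      frame_condition_number (g1 \<gamma>) (rect_lattice a b) = B \<gamma> / A \<gamma> \<and>
      B \<gamma> / A \<gamma> = exp (2 * a * \<gamma>)"
    by blast
qed

end
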